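(* Let $(S,R)$ be a Randers manifold, $R(y)=\sqrt{h(y,y)}+\omega(y)$, with reversed metric $\tilde R(y)=\sqrt{h(y,y)}-\omega(y)$. Let $D\subset S$ be a domain of class $C^{2}$, let $x\in\partial D$, and let $\phi:U\to\mathbb{R}$ be a $C^2$ function on a neighborhood $U$ of $x$ with $\phi^{-1}(0)=U\cap\partial D$, $\phi>0$ on $U\cap D$ and $\mathrm{d}\phi\neq 0$ at every point of $U\cap\partial D$. Then the following are equivalent: (i) $(\partial D;R)$ is infinitesimally convex at $x$; (ii) $(\partial D;\tilde R)$ is infinitesimally convex at $x$; (iii) for all $y\in T_x\partial D$, $\ H^h_\phi(y,y)+\sqrt{h(y,y)}\,\mathrm{d}\omega(y,\nabla^h\phi)\le 0$; (iv) for all $y\in T_x\partial D$, $\ H^h_\phi(y,y)-\sqrt{h(y,y)}\,\mathrm{d}\omega(y,\nabla^h\phi)\le 0$; (v) for all $y\in T_x\partial D$, $\ H^h_\phi(y,y)+\sqrt{h(y,y)}\,\big|\mathrm{d}\omega(y,\nabla^h\phi)\big|\le 0$.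
   Context: A Randers manifold $(S,R)$ is a manifold $S$ with a Riemannian metric $h$ and a one-form $\omega$ with $\|\omega\|_x=\sup_{y\in T_xS\setminus\{0\}}|\omega(y)|/\sqrt{h(y,y)}<1$ for all $x\in S$, endowed with the Finsler metric $R(y)=\sqrt{h(y,y)}+\omega(y)$ (data are regular enough that the fundamental tensor of $R$ is $C^{1,1}_{\rm loc}$ off the zero section, e.g. smooth). A domain is an open connected subset; it is of class $C^2$ if its closure is a manifold with boundary and $\partial D$ is locally the inverse image of a regular value of a $C^2$ function. $\nabla^h\phi$ and $H^h_\phi$ are the gradient and the Hessian of $\phi$ with respect to $h$ (Levi-Civita connection). For a Finsler metric $F$ on $M$, $H_\phi=\nabla(\mathrm{d}\phi)$ denotes the Hessian with respect to the Chern connection; it satisfies $(H_\phi)_{y}(y,y)=(\phi\circ\gamma)''(0)$, where $\gamma$ is the constant-$F$-speed geodesic of $F$ with $\dot\gamma(0)=y\neq 0$. $(\partial D;F)$ is infinitesimally convex at $x\in\partial D$ if for one (and then for all) $C^2$ function $\phi$ defined near $x$, with $\phi^{-1}(0)=U\cap\partial D$, $\phi>0$ on $U\cap D$, $\mathrm{d}\phi\ne0$ on $U\cap\partial D$, one has $(H_\phi)_y(y,y)\le0$ for every $y\in T_x\partial D\setminus\{0\}$. *)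

theory Defs
  imports "HOL-Analysis.Analysis"
begin

section \<open>Functions of class \<open>C\<^sup>k\<close> on open subsets of a normed space\<close>

primrec C_k_on :: "nat \<Rightarrow> ('v::real_normed_vector \<Rightarrow> 'w::real_normed_vector) \<Rightarrow> 'v set \<Rightarrow> bool" where
  "C_k_on 0 f S \<longleftrightarrow> continuous_on S f"
| "C_k_on (Suc k) f S \<longleftrightarrow>
     (\<forall>p\<in>S. f differentiable (at p)) \<and> (\<forall>v. C_k_on k (\<lambda>p. frechet_derivative f (at p) v) S)"

definition smooth_on :: "('v::real_normed_vector \<Rightarrow> 'w::real_normed_vector) \<Rightarrow> 'v set \<Rightarrow> bool" where
  "smooth_on f S \<longleftrightarrow> (\<forall>k. C_k_on k f S)"

text \<open>Class \<open>C\<^sup>1\<^sup>,\<^sup>1\<close>, locally; in finite dimension it is enough that every directional derivative is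
  locally Lipschitz.\<close>

definition C11_loc_on :: "('v::euclidean_space \<Rightarrow> real) \<Rightarrow> 'v set \<Rightarrow> bool" where
  "C11_loc_on f S \<longleftrightarrow>
     (\<forall>p\<in>S. f differentiable (at p)) \<and>
     (\<forall>v. \<forall>p\<in>S. \<exists>e>0. \<exists>L. L-lipschitz_on (ball p e \<inter> S) (\<lambda>q. frechet_derivative f (at q) v))"

definition second_derivative :: "('v::real_normed_vector \<Rightarrow> real) \<Rightarrow> 'v \<Rightarrow> 'v \<Rightarrow> 'v \<Rightarrow> real" where
  "second_derivative f p u v =
     frechet_derivative (\<lambda>q. frechet_derivative f (at q) v) (at p) u"


section \<open>Manifolds\<close>

text \<open>The manifold is the whole type \<open>'a\<close>; a chart is an open set together with a map into the
  model space \<open>'e\<close>, so that the dimension is \<open>DIM('e)\<close>.\<close>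

type_synonym ('a, 'e) chart = "'a set \<times> ('a \<Rightarrow> 'e)"

abbreviation cdom :: "('a, 'e) chart \<Rightarrow> 'a set" where "cdom c \<equiv> fst c"

abbreviation cmap :: "('a, 'e) chart \<Rightarrow> 'a \<Rightarrow> 'e" where "cmap c \<equiv> snd c"

definition cinv :: "('a, 'e) chart \<Rightarrow> 'e \<Rightarrow> 'a" where
  "cinv c = inv_into (cdom c) (cmap c)"

definition is_chart :: "('a::topological_space, 'e::euclidean_space) chart \<Rightarrow> bool" where
  "is_chart c \<longleftrightarrow> open (cdom c) \<and> open (cmap c ` cdom c) \<and>
     homeomorphism (cdom c) (cmap c ` cdom c) (cmap c) (cinv c)"

definition smooth_atlas :: "('a::topological_space, 'e::euclidean_space) chart set \<Rightarrow> bool" where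
  "smooth_atlas A \<longleftrightarrow> (\<forall>c\<in>A. is_chart c) \<and> (\<Union>c\<in>A. cdom c) = UNIV \<and>
     (\<forall>c\<in>A. \<forall>d\<in>A. smooth_on (cmap d \<circ> cinv c) (cmap c ` (cdom c \<inter> cdom d)))"

text \<open>Classical tensor expressions below (differential, Hessians, exterior derivative) are evaluated
  in one chart around the point; being tensorial, they do not depend on which one.\<close>

definition chart_at :: "('a, 'e) chart set \<Rightarrow> 'a \<Rightarrow> ('a, 'e) chart" where
  "chart_at A x = (SOME c. c \<in> A \<and> x \<in> cdom c)"

text \<open>A tangent vector at \<open>x\<close> is the family of its components in the charts around \<open>x\<close>, related by
  the differentials of the transition maps (and \<open>0\<close> at all other indices).\<close>

type_synonym ('a, 'e) tangent = "('a, 'e) chart \<Rightarrow> 'e"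

definition tangent_space ::
  "('a, 'e::euclidean_space) chart set \<Rightarrow> 'a \<Rightarrow> ('a, 'e) tangent set" where
  "tangent_space A x = {v.
     (\<forall>c. \<not> (c \<in> A \<and> x \<in> cdom c) \<longrightarrow> v c = 0) \<and>
     (\<forall>c\<in>A. \<forall>d\<in>A. x \<in> cdom c \<inter> cdom d \<longrightarrow>
        v d = frechet_derivative (cmap d \<circ> cinv c) (at (cmap c x)) (v c))}"

abbreviation zero_tangent :: "('a, 'e::euclidean_space) tangent" where
  "zero_tangent \<equiv> (\<lambda>_. 0)"

text \<open>The tangent vector at \<open>x\<close> whose component in the chart \<open>c\<close> is \<open>a\<close>; for a chart \<open>c\<close> around \<open>x\<close>
  this is the linear isomorphism from the model space onto the tangent space.\<close>

definition tvec ::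
  "('a, 'e::euclidean_space) chart set \<Rightarrow> 'a \<Rightarrow> ('a, 'e) chart \<Rightarrow> 'e \<Rightarrow> ('a, 'e) tangent" where
  "tvec A x c a = (\<lambda>d. if d \<in> A \<and> x \<in> cdom d
     then frechet_derivative (cmap d \<circ> cinv c) (at (cmap c x)) a else 0)"

definition C2_function_on ::
  "('a, 'e::euclidean_space) chart set \<Rightarrow> 'a set \<Rightarrow> ('a \<Rightarrow> real) \<Rightarrow> bool" where
  "C2_function_on A U f \<longleftrightarrow> (\<forall>c\<in>A. C_k_on 2 (f \<circ> cinv c) (cmap c ` (cdom c \<inter> U)))"

definition differential ::
  "('a, 'e::euclidean_space) chart set \<Rightarrow> ('a \<Rightarrow> real) \<Rightarrow> 'a \<Rightarrow> ('a, 'e) tangent \<Rightarrow> real" where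
  "differential A f x v =
     (let c = chart_at A x in frechet_derivative (f \<circ> cinv c) (at (cmap c x)) (v c))"


section \<open>Riemannian metrics and one-forms\<close>

type_synonym ('a, 'e) metric = "'a \<Rightarrow> ('a, 'e) tangent \<Rightarrow> ('a, 'e) tangent \<Rightarrow> real"

type_synonym ('a, 'e) tangent_function = "'a \<Rightarrow> ('a, 'e) tangent \<Rightarrow> real"

text \<open>Local representatives: the argument \<open>p\<close> ranges over the image of the chart \<open>c\<close>.\<close>

definition loc1 :: "('a, 'e::euclidean_space) chart set \<Rightarrow> ('a, 'e) tangent_function \<Rightarrow>
    ('a, 'e) chart \<Rightarrow> 'e \<Rightarrow> 'e \<Rightarrow> real" where
  "loc1 A F c p u = F (cinv c p) (tvec A (cinv c p) c u)"

definition loc2 :: "('a, 'e::euclidean_space) chart set \<Rightarrow> ('a, 'e) metric \<Rightarrow>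
    ('a, 'e) chart \<Rightarrow> 'e \<Rightarrow> 'e \<Rightarrow> 'e \<Rightarrow> real" where
  "loc2 A h c p u v = h (cinv c p) (tvec A (cinv c p) c u) (tvec A (cinv c p) c v)"

text \<open>The next two predicates are pointwise. The regularity of \<open>h\<close> and \<open>\<omega>\<close> is part of the definition
  of a Randers manifold, where it is imposed through the fundamental tensor.\<close>

definition inner_product_field ::
  "('a, 'e::euclidean_space) chart set \<Rightarrow> ('a, 'e) metric \<Rightarrow> bool" where
  "inner_product_field A h \<longleftrightarrow>
     (\<forall>c\<in>A. \<forall>p\<in>cmap c ` cdom c. bilinear (loc2 A h c p)) \<and>
     (\<forall>x. \<forall>u\<in>tangent_space A x. \<forall>v\<in>tangent_space A x. h x u v = h x v u) \<and>
     (\<forall>x. \<forall>v\<in>tangent_space A x - {zero_tangent}. 0 < h x v v)"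

definition covector_field ::
  "('a, 'e::euclidean_space) chart set \<Rightarrow> ('a, 'e) tangent_function \<Rightarrow> bool" where
  "covector_field A \<omega> \<longleftrightarrow> (\<forall>c\<in>A. \<forall>p\<in>cmap c ` cdom c. linear (loc1 A \<omega> c p))"

definition gradient :: "('a, 'e::euclidean_space) chart set \<Rightarrow> ('a, 'e) metric \<Rightarrow> ('a \<Rightarrow> real) \<Rightarrow>
    'a \<Rightarrow> ('a, 'e) tangent" where
  "gradient A h f x =
     (THE n. n \<in> tangent_space A x \<and> (\<forall>v\<in>tangent_space A x. h x n v = differential A f x v))"

text \<open>\<open>d\<omega>(u,v) = u(\<omega>(v)) - v(\<omega>(u))\<close> for fields \<open>u, v\<close> with constant components, without a factor 1/2.\<close>

definition ext_deriv :: "('a, 'e::euclidean_space) chart set \<Rightarrow> ('a, 'e) tangent_function \<Rightarrow>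
    'a \<Rightarrow> ('a, 'e) tangent \<Rightarrow> ('a, 'e) tangent \<Rightarrow> real" where
  "ext_deriv A \<omega> x u v = (let c = chart_at A x in
     frechet_derivative (\<lambda>p. loc1 A \<omega> c p (v c)) (at (cmap c x)) (u c) -
     frechet_derivative (\<lambda>p. loc1 A \<omega> c p (u c)) (at (cmap c x)) (v c))"

text \<open>Christoffel symbols as a bilinear map: \<open>\<Gamma>(u,v) = \<nabla>\<^sub>u v\<close> for fields with constant components, \<open>\<nabla>\<close>
  the torsion-free metric connection.\<close>

definition levi_civita :: "('a, 'e::euclidean_space) chart set \<Rightarrow> ('a, 'e) metric \<Rightarrow>
    ('a, 'e) chart \<Rightarrow> 'e \<Rightarrow> 'e \<Rightarrow> 'e \<Rightarrow> 'e" where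
  "levi_civita A h c p = (THE \<Gamma>. bilinear \<Gamma> \<and> (\<forall>u v. \<Gamma> u v = \<Gamma> v u) \<and>
     (\<forall>u v w. frechet_derivative (\<lambda>q. loc2 A h c q v w) (at p) u =
        loc2 A h c p (\<Gamma> u v) w + loc2 A h c p v (\<Gamma> u w)))"

definition riemannian_hessian :: "('a, 'e::euclidean_space) chart set \<Rightarrow> ('a, 'e) metric \<Rightarrow>
    ('a \<Rightarrow> real) \<Rightarrow> 'a \<Rightarrow> ('a, 'e) tangent \<Rightarrow> ('a, 'e) tangent \<Rightarrow> real" where
  "riemannian_hessian A h f x u v = (let c = chart_at A x; p = cmap c x in
     second_derivative (f \<circ> cinv c) p (u c) (v c) -
     frechet_derivative (f \<circ> cinv c) (at p) (levi_civita A h c p (u c) (v c)))"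


section \<open>Finsler metrics and the Chern connection\<close>

text \<open>\<open>g\<^sub>y(u,v) = 1/2 \<partial>\<^sub>s \<partial>\<^sub>t F\<^sup>2(y + s u + t v)\<close> at \<open>s = t = 0\<close>.\<close>

definition fundamental_tensor :: "('a, 'e::euclidean_space) chart set \<Rightarrow>
    ('a, 'e) tangent_function \<Rightarrow> ('a, 'e) chart \<Rightarrow> 'e \<Rightarrow> 'e \<Rightarrow> 'e \<Rightarrow> 'e \<Rightarrow> real" where
  "fundamental_tensor A F c p y u v =
     deriv (\<lambda>s. deriv (\<lambda>t. (loc1 A F c p (y + s *\<^sub>R u + t *\<^sub>R v))\<^sup>2 / 2) 0) 0"

definition C11_fundamental_tensor :: "('a, 'e::euclidean_space) chart set \<Rightarrow>
    ('a, 'e) tangent_function \<Rightarrow> bool" where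
  "C11_fundamental_tensor A F \<longleftrightarrow> (\<forall>c\<in>A. \<forall>u v.
     C11_loc_on (\<lambda>(p, y). fundamental_tensor A F c p y u v) ((cmap c ` cdom c) \<times> (- {0})))"

text \<open>The Chern connection with reference vector \<open>y \<noteq> 0\<close>, again as \<open>\<Gamma>(u,v) = \<nabla>\<^sub>u v\<close> for fields with
  constant components: the torsion-free connection that is almost compatible with the metric, i.e.
  \<open>X g\<^sub>V(Y,Z) = g\<^sub>V(\<nabla>\<^sub>X Y, Z) + g\<^sub>V(Y, \<nabla>\<^sub>X Z) + 2 C\<^sub>V(\<nabla>\<^sub>X V, Y, Z)\<close>, where \<open>2 C\<close> (twice the Cartan tensor)
  is the derivative of \<open>g\<close> along the fibre. Taking all fields with constant components, \<open>V = y\<close>, the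
  field \<open>\<nabla>\<^sub>X V\<close> is \<open>\<Gamma>(u,y)\<close>, the nonlinear connection.\<close>

definition chern_connection :: "('a, 'e::euclidean_space) chart set \<Rightarrow>
    ('a, 'e) tangent_function \<Rightarrow> ('a, 'e) chart \<Rightarrow> 'e \<Rightarrow> 'e \<Rightarrow> 'e \<Rightarrow> 'e \<Rightarrow> 'e" where
  "chern_connection A F c p y = (THE \<Gamma>. bilinear \<Gamma> \<and> (\<forall>u v. \<Gamma> u v = \<Gamma> v u) \<and>
     (\<forall>u v w. frechet_derivative (\<lambda>q. fundamental_tensor A F c q y v w) (at p) u =
        fundamental_tensor A F c p y (\<Gamma> u v) w + fundamental_tensor A F c p y v (\<Gamma> u w) +
        frechet_derivative (\<lambda>z. fundamental_tensor A F c p z v w) (at y) (\<Gamma> u y)))"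

text \<open>\<open>(H\<^sub>f)\<^sub>y(u,v)\<close> with \<open>H\<^sub>f = \<nabla>(df)\<close>.\<close>

definition finsler_hessian :: "('a, 'e::euclidean_space) chart set \<Rightarrow>
    ('a, 'e) tangent_function \<Rightarrow> ('a \<Rightarrow> real) \<Rightarrow> 'a \<Rightarrow>
    ('a, 'e) tangent \<Rightarrow> ('a, 'e) tangent \<Rightarrow> ('a, 'e) tangent \<Rightarrow> real" where
  "finsler_hessian A F f x y u v = (let c = chart_at A x; p = cmap c x in
     second_derivative (f \<circ> cinv c) p (u c) (v c) -
     frechet_derivative (f \<circ> cinv c) (at p) (chern_connection A F c p (y c) (u c) (v c)))"


section \<open>Randers manifolds\<close>

definition randers_metric ::
  "('a, 'e) metric \<Rightarrow> ('a, 'e) tangent_function \<Rightarrow> ('a, 'e) tangent_function" where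
  "randers_metric h \<omega> = (\<lambda>x y. sqrt (h x y y) + \<omega> x y)"

definition reversed_randers_metric ::
  "('a, 'e) metric \<Rightarrow> ('a, 'e) tangent_function \<Rightarrow> ('a, 'e) tangent_function" where
  "reversed_randers_metric h \<omega> = (\<lambda>x y. sqrt (h x y y) - \<omega> x y)"

text \<open>The fundamental tensor being \<open>C\<^sup>1\<^sup>,\<^sup>1\<close> off the zero section is equivalent to \<open>h\<close> and \<open>\<omega>\<close> being
  \<open>C\<^sup>1\<^sup>,\<^sup>1\<close>, because \<open>g\<^sub>y(y,y) = R(y)\<^sup>2\<close> and \<open>R(y) \<plusminus> R(-y)\<close> are twice the norm of \<open>h\<close> and twice \<open>\<omega>\<close>.
  The supremum is over a nonempty bounded set.\<close>

definition randers_manifold :: "('a::topological_space, 'e::euclidean_space) chart set \<Rightarrow>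
    ('a, 'e) metric \<Rightarrow> ('a, 'e) tangent_function \<Rightarrow> bool" where
  "randers_manifold A h \<omega> \<longleftrightarrow>
     smooth_atlas A \<and> inner_product_field A h \<and> covector_field A \<omega> \<and>
     (\<forall>x. (SUP y\<in>tangent_space A x - {zero_tangent}. \<bar>\<omega> x y\<bar> / sqrt (h x y y)) < 1) \<and>
     C11_fundamental_tensor A (randers_metric h \<omega>)"


section \<open>Domains and infinitesimal convexity\<close>

text \<open>Manifold with boundary is understood in the topological sense.\<close>

definition C2_domain ::
  "('a::topological_space, 'e::euclidean_space) chart set \<Rightarrow> 'a set \<Rightarrow> bool" where
  "C2_domain A D \<longleftrightarrow> open D \<and> connected D \<and>
     (\<forall>z\<in>closure D. \<exists>V. \<exists>b\<in>Basis. \<exists>W::'e set.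
        openin (top_of_set (closure D)) V \<and> z \<in> V \<and>
        openin (top_of_set {p. 0 \<le> p \<bullet> b}) W \<and> V homeomorphic W) \<and>
     (\<forall>z\<in>frontier D. \<exists>V f r. open V \<and> z \<in> V \<and> C2_function_on A V f \<and>
        (\<forall>q\<in>V. f q = r \<longrightarrow> (\<exists>v\<in>tangent_space A q. differential A f q v \<noteq> 0)) \<and>
        V \<inter> frontier D = {q\<in>V. f q = r})"

text \<open>The tangent space at \<open>x\<close> of the hypersurface \<open>\<partial>D\<close>: velocities of \<open>C\<^sup>1\<close> curves contained in it.\<close>

definition boundary_tangent_space ::
  "('a::topological_space, 'e::euclidean_space) chart set \<Rightarrow> 'a set \<Rightarrow> 'a \<Rightarrow> ('a, 'e) tangent set" where
  "boundary_tangent_space A D x = {v \<in> tangent_space A x.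
     \<exists>\<gamma> e. 0 < e \<and> \<gamma> 0 = x \<and> continuous_on {-e<..<e} \<gamma> \<and> \<gamma> ` {-e<..<e} \<subseteq> frontier D \<and>
       (\<forall>c\<in>A. (cmap c \<circ> \<gamma>) C1_differentiable_on {t \<in> {-e<..<e}. \<gamma> t \<in> cdom c}) \<and>
       (\<forall>c\<in>A. x \<in> cdom c \<longrightarrow> ((cmap c \<circ> \<gamma>) has_vector_derivative v c) (at 0))}"

definition defining_function :: "('a::topological_space, 'e::euclidean_space) chart set \<Rightarrow>
    'a set \<Rightarrow> 'a \<Rightarrow> 'a set \<Rightarrow> ('a \<Rightarrow> real) \<Rightarrow> bool" where
  "defining_function A D x U f \<longleftrightarrow>
     open U \<and> x \<in> U \<and> C2_function_on A U f \<and>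
     {q\<in>U. f q = 0} = U \<inter> frontier D \<and> (\<forall>q\<in>U \<inter> D. 0 < f q) \<and>
     (\<forall>q\<in>U \<inter> frontier D. \<exists>v\<in>tangent_space A q. differential A f q v \<noteq> 0)"

definition infinitesimally_convex :: "('a::topological_space, 'e::euclidean_space) chart set \<Rightarrow>
    ('a, 'e) tangent_function \<Rightarrow> 'a set \<Rightarrow> 'a \<Rightarrow> bool" where
  "infinitesimally_convex A F D x \<longleftrightarrow> (\<exists>U f. defining_function A D x U f \<and>
     (\<forall>y\<in>boundary_tangent_space A D x - {zero_tangent}. finsler_hessian A F f x y y y \<le> 0))"

end

theory Submission
  imports Defs
begin

text \<open>
  For \<open>y\<close> tangent to the boundary, hence \<open>d\<phi>(y) = 0\<close>, the geodesics of a Randers metric are, up to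
  parametrization, the trajectories of a magnetic field: in the direction of the gradient of
  \<open>\<phi>\<close> the Chern connection differs from the Levi-Civita connection by the Lorentz force. This gives
  \<open>H\<^sup>R\<^sub>\<phi>(y,y) = H\<^sup>h\<^sub>\<phi>(y,y) - |y| d\<omega>(y, \<nabla>\<phi>)\<close> (\<open>finsler_hessian_randers\<close>), and the opposite sign for the
  reversed metric, which is the Randers metric of \<open>-\<omega>\<close>. The tangent space of the boundary is
  symmetric under \<open>y \<mapsto> -y\<close>, the Hessian of \<open>h\<close> is even in \<open>y\<close> and the magnetic term is odd, so
  the inequality with either sign implies the one with the other, and both together are the one with
  the absolute value.

  The identity is obtained by testing the equation of the connection (\<open>connection_diagonal\<close>), with
  the explicit fundamental tensor of \<open>R\<close>, against \<open>y\<close> and against \<open>\<nabla>\<phi>\<close> (\<open>randers_chern_diagonal\<close>). Since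
  both connections are given by definite descriptions, their existence and uniqueness is proved
  first (\<open>almost_compatible_connection_ex1\<close>).

  Infinitesimal convexity asks for some defining function. That any other one may be used follows
  from \<open>defining_functions_proportional\<close>: two defining functions have, up to a positive factor, the
  same differential at the point and the same second derivative on its kernel.
\<close>

section \<open>Almost metric connections on a vector space\<close>

text \<open>Symmetry is not needed here, only positivity on the diagonal; in finite dimension injectivity
  of \<open>a \<mapsto> g(a, \<cdot>)\<close> already gives surjectivity.\<close>
lemma bilinear_riesz:
  fixes g :: "'e::euclidean_space \<Rightarrow> 'e \<Rightarrow> real"
  assumes g: "bilinear g" and pos: "\<And>u. u \<noteq> 0 \<Longrightarrow> 0 < g u u" and L: "linear L"
  shows "\<exists>!a. \<forall>w. g a w = L w"
proof -
  define T where "T a = (\<Sum>b\<in>Basis. g a b *\<^sub>R b)" for a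
  have lin1: "linear (\<lambda>a. g a w)" and lin2: "linear (g w)" for w
    using g by (auto simp: bilinear_def)
  have T: "linear T"
    by (rule linearI) (simp_all add: T_def linear_add[OF lin1] linear_scale[OF lin1]
        scaleR_left_distrib sum.distrib scaleR_sum_right)
  have Tb: "T a \<bullet> b = g a b" if "b \<in> Basis" for a b
    using that by (simp add: T_def inner_sum_left inner_Basis if_distrib cong: if_cong)
  have eqI: "g a = L'" if "linear L'" "\<And>b. b \<in> Basis \<Longrightarrow> g a b = L' b" for a L'
    using lin2 that by (blast intro: linear_eq_stdbasis)
  have "inj T"
  proof (rule linear_injective_0[OF T, THEN iffD2], intro allI impI)
    fix a assume "T a = 0"
    then have "g a = (\<lambda>_. 0)"
      by (intro eqI) (auto simp: Tb[symmetric] linear_zero)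
    then show "a = 0" using pos[of a] by force
  qed
  then have "surj T" using T by (simp add: linear_injective_imp_surjective)
  then obtain a where a: "T a = (\<Sum>b\<in>Basis. L b *\<^sub>R b)" by (metis surjD)
  have "g a b = L b" if "b \<in> Basis" for b
    using that by (simp add: Tb[symmetric] a inner_sum_left inner_Basis if_distrib cong: if_cong)
  then have ga: "g a = L" using L by (intro eqI)
  show ?thesis
  proof (intro ex1I[of _ a] allI)
    fix a' assume "\<forall>w. g a' w = L w"
    then have "g (a' - a) (a' - a) = 0"
      by (simp add: linear_diff[OF lin1] ga)
    then show "a' = a" using pos[of "a' - a"] by force
  qed (simp add: ga)
qed

lemma bilinear_eqI:
  fixes g :: "'e::euclidean_space \<Rightarrow> 'e \<Rightarrow> real"
  assumes g: "bilinear g" and pos: "\<And>u. u \<noteq> 0 \<Longrightarrow> 0 < g u u" and eq: "\<And>w. g a w = g b w"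
  shows "a = b"
proof -
  have "linear (g b)" using g by (simp add: bilinear_def)
  then show ?thesis using bilinear_riesz[OF g pos, of "g b"] eq by auto
qed

lemma bilinear_represent:
  fixes g :: "'e::euclidean_space \<Rightarrow> 'e \<Rightarrow> real"
  assumes g: "bilinear g" and pos: "\<And>u. u \<noteq> 0 \<Longrightarrow> 0 < g u u"
    and K1: "\<And>v w. linear (\<lambda>u. K u v w)" and K2: "\<And>u w. linear (\<lambda>v. K u v w)"
    and K3: "\<And>u v. linear (K u v)"
  obtains \<Gamma> where "bilinear \<Gamma>" "\<And>u v w. g (\<Gamma> u v) w = K u v w"
proof -
  have "\<exists>a. \<forall>w. g a w = K u v w" for u v
    using bilinear_riesz[OF g pos K3[of u v]] by blast
  then obtain \<Gamma> where \<Gamma>: "\<And>u v w. g (\<Gamma> u v) w = K u v w" by metis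
  have eqI: "a = b" if "\<And>w. g a w = g b w" for a b
    using pos that by (intro bilinear_eqI[OF g])
  have "linear (\<Gamma> u)" for u
    by (intro linearI eqI) (simp_all add: \<Gamma> bilinear_ladd[OF g] bilinear_lmul[OF g]
        linear_add[OF K2] linear_scale[OF K2])
  moreover have "linear (\<lambda>u. \<Gamma> u v)" for v
    by (intro linearI eqI) (simp_all add: \<Gamma> bilinear_ladd[OF g] bilinear_lmul[OF g]
        linear_add[OF K1] linear_scale[OF K1])
  ultimately show ?thesis using \<Gamma> by (intro that[of \<Gamma>]) (simp_all add: bilinear_def)
qed

text \<open>The algebra behind both the Levi-Civita connection (\<open>C = 0\<close>) and the Chern connection with
  reference vector \<open>y\<close>: \<open>D u\<close> stands for the derivative of the metric along \<open>u\<close> and \<open>C\<close> for twice the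
  Cartan tensor. The condition on \<open>\<Gamma>\<close> is implicit because \<open>\<Gamma>(u,y)\<close> occurs in the last term, but
  \<open>C(\<cdot>, y, \<cdot>) = 0\<close> makes Koszul's formula triangular: it determines \<open>\<Gamma>(y,y)\<close> outright, then
  \<open>\<Gamma>(u,y)\<close> from \<open>\<Gamma>(y,y)\<close>, and finally \<open>\<Gamma>(u,v)\<close> from \<open>\<Gamma>(u,y)\<close> and \<open>\<Gamma>(v,y)\<close>.\<close>
lemma almost_compatible_connection_ex1:
  fixes g :: "'e::euclidean_space \<Rightarrow> 'e \<Rightarrow> real" and D C :: "'e \<Rightarrow> 'e \<Rightarrow> 'e \<Rightarrow> real"
  assumes g: "bilinear g" and pos: "\<And>u. u \<noteq> 0 \<Longrightarrow> 0 < g u u" and sym: "\<And>u v. g u v = g v u"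
    and D1: "\<And>v w. linear (\<lambda>u. D u v w)" and D: "\<And>u. bilinear (D u)"
    and Dsym: "\<And>u v w. D u v w = D u w v"
    and C1: "\<And>v w. linear (\<lambda>u. C u v w)" and C: "\<And>u. bilinear (C u)"
    and Csym: "\<And>u v w. C u v w = C u w v"
    and C0: "\<And>z w. C z y w = 0"
  shows "\<exists>!\<Gamma>. bilinear \<Gamma> \<and> (\<forall>u v. \<Gamma> u v = \<Gamma> v u) \<and>
    (\<forall>u v w. D u v w = g (\<Gamma> u v) w + g v (\<Gamma> u w) + C (\<Gamma> u y) v w)"
proof -
  have eqI: "a = b" if "\<And>w. g a w = g b w" for a b
    using pos that by (intro bilinear_eqI[OF g])
  have D2: "linear (\<lambda>v. D u v w)" and D3: "linear (D u v)"
    and C2: "linear (\<lambda>v. C u v w)" and C3: "linear (C u v)" for u v w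
    using D C by (auto simp: bilinear_def)
  have C0': "C z w y = 0" for z w using C0 Csym by simp
  have CN: "linear (\<lambda>u. C (N u) v w)" if "linear N" for N :: "'e \<Rightarrow> 'e" and v w
    using linear_compose[OF that C1] by (simp add: o_def)
  \<comment> \<open>\<open>G\<close> will be \<open>\<Gamma>(y,y)\<close>, \<open>N u\<close> will be \<open>\<Gamma>(u,y)\<close>, and \<open>K\<close> is the right-hand side of Koszul's formula.\<close>
  obtain G where G: "\<And>w. g G w = D y y w - D w y y / 2"
  proof -
    have "linear (\<lambda>w. D y y w - (1/2) *\<^sub>R D w y y)"
      by (intro linear_compose_sub linear_compose_scale_right D1 D3)
    then show ?thesis using bilinear_riesz[OF g pos] that by force
  qed
  define K1 where "K1 u w = (1/2) *\<^sub>R (D u y w + D y u w - D w u y - C G u w)" for u w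
  define K where "K N u v w = (1/2) *\<^sub>R (D u v w + D v u w - D w u v
    - C (N u) v w - C (N v) u w + C (N w) u v)" for N u v w
  have K1_lin: "linear (\<lambda>u. K1 u w)" "linear (K1 u)" for u w
    unfolding K1_def
    by (intro linear_compose_scale_right linear_compose_sub linear_compose_add D1 D2 D3 C1 C2 C3)+
  have "\<exists>a. \<forall>w. g a w = K1 u w" for u
    using bilinear_riesz[OF g pos K1_lin(2)] by blast
  then obtain N where N: "\<And>u w. g (N u) w = K1 u w" by metis
  have N_lin: "linear N"
    by (intro linearI eqI) (simp_all add: N bilinear_ladd[OF g] bilinear_lmul[OF g]
        linear_add[OF K1_lin(1)] linear_scale[OF K1_lin(1)])
  have Ny: "N y = G"
    by (rule eqI) (simp add: N K1_def G C0 field_simps)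
  have "linear (\<lambda>u. K N u v w)" "linear (\<lambda>v. K N u v w)" "linear (K N u v)" for u v w
    unfolding K_def
    by (intro linear_compose_scale_right linear_compose_sub linear_compose_add D1 D2 D3 C1 C2 C3
        CN N_lin)+
  then obtain \<Gamma> where \<Gamma>: "bilinear \<Gamma>" "\<And>u v w. g (\<Gamma> u v) w = K N u v w"
    using bilinear_represent[OF g pos, of "K N"] by metis
  have \<Gamma>sym: "\<Gamma> u v = \<Gamma> v u" for u v
    by (rule eqI) (simp add: \<Gamma> K_def Dsym[of _ u v] Csym[of _ u v])
  have \<Gamma>y: "\<Gamma> u y = N u" for u
    by (rule eqI) (simp add: \<Gamma> N K_def K1_def Ny C0 C0')
  have compat: "D u v w = g (\<Gamma> u v) w + g v (\<Gamma> u w) + C (\<Gamma> u y) v w" for u v w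
    unfolding \<Gamma>y sym[of v] \<Gamma> K_def
    using Dsym[of u v w] Dsym[of v u w] Dsym[of w u v] Csym[of "N u" v w] Csym[of "N v" u w]
      Csym[of "N w" u v] by (simp add: field_simps)
  show ?thesis
  proof (intro ex1I[of _ \<Gamma>] conjI allI)
    fix \<Delta>
    assume \<Delta>: "bilinear \<Delta> \<and> (\<forall>u v. \<Delta> u v = \<Delta> v u) \<and>
      (\<forall>u v w. D u v w = g (\<Delta> u v) w + g v (\<Delta> u w) + C (\<Delta> u y) v w)"
    then have s: "\<Delta> u v = \<Delta> v u" 
      and c: "D u v w = g (\<Delta> u v) w + g v (\<Delta> u w) + C (\<Delta> u y) v w" for u v w by blast+
    have koszul: "g (\<Delta> u v) w = K (\<lambda>u. \<Delta> u y) u v w" for u v w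
      using c[of u v w] c[of v u w] c[of w u v] sym[of v "\<Delta> u w"] sym[of u "\<Delta> v w"]
        sym[of v "\<Delta> w u"] sym[of u "\<Delta> w v"] s[of u v] s[of u w] s[of v w]
      by (simp add: K_def)
    have "\<Delta> y y = G"
      by (rule eqI) (simp add: koszul K_def G C0 C0' field_simps)
    then have "\<Delta> u y = N u" for u
      by (intro eqI) (simp add: koszul N K_def K1_def C0 C0')
    then show "\<Delta> = \<Gamma>"
      by (intro ext eqI) (simp add: koszul \<Gamma> K_def)
  qed (use \<Gamma>(1) \<Gamma>sym compat in auto)
qed

lemma connection_diagonal:
  fixes g :: "'e::euclidean_space \<Rightarrow> 'e \<Rightarrow> real" 
  assumes sym: "\<And>u v. g u v = g v u" and \<Gamma>sym: "\<And>u v. \<Gamma> u v = \<Gamma> v u"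
    and C0: "\<And>z w. C z y w = 0"
    and c: "\<And>u v w. D u v w = g (\<Gamma> u v) w + g v (\<Gamma> u w) + C (\<Gamma> u y) v w"
  shows "g (\<Gamma> y y) w = D y y w - D w y y / 2"
  using c[of y y w] c[of w y y] sym[of y "\<Gamma> w y"] \<Gamma>sym[of w y] C0
  by (simp add: field_simps)

lemma bilinear_frechet_derivative:
  fixes G :: "'v::real_normed_vector \<Rightarrow> 'e::real_vector \<Rightarrow> 'e \<Rightarrow> real"
  assumes "open S" "p \<in> S" and G: "\<And>q. q \<in> S \<Longrightarrow> bilinear (G q)"
    and d: "\<And>v w. (\<lambda>q. G q v w) differentiable (at p)"
  shows "bilinear (\<lambda>v w. frechet_derivative (\<lambda>q. G q v w) (at p) u)"
proof -
  let ?D = "\<lambda>v w. frechet_derivative (\<lambda>q. G q v w) (at p)"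
  have D: "((\<lambda>q. G q v w) has_derivative ?D v w) (at p)" for v w
    using d frechet_derivative_works by blast
  have eq: "?D v w = f'" if "((\<lambda>q. f q) has_derivative f') (at p)" "\<And>q. q \<in> S \<Longrightarrow> f q = G q v w"
    for f f' v w
    using has_derivative_transform_within_open[OF that(1) assms(1,2) that(2)] D
      has_derivative_unique by blast
  show ?thesis
    unfolding bilinear_def
  proof (intro conjI allI linearI)
    fix x y z :: 'e and r :: real
    show "?D x (y + z) u = ?D x y u + ?D x z u"
      using eq[OF has_derivative_add[OF D[of x y] D[of x z]]] by (simp add: bilinear_radd[OF G])
    show "?D (y + z) x u = ?D y x u + ?D z x u"
      using eq[OF has_derivative_add[OF D[of y x] D[of z x]]] by (simp add: bilinear_ladd[OF G])
    show "?D x (r *\<^sub>R y) u = r *\<^sub>R ?D x y u"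
      using eq[OF has_derivative_scaleR_right[OF D[of x y], of r]] by (simp add: bilinear_rmul[OF G])
    show "?D (r *\<^sub>R y) x u = r *\<^sub>R ?D y x u"
      using eq[OF has_derivative_scaleR_right[OF D[of y x], of r]] by (simp add: bilinear_lmul[OF G])
  qed
qed

section \<open>The fundamental tensor of a Randers norm\<close>

text \<open>The fundamental tensor of the Minkowski norm \<open>F(y) = sqrt (H(y,y)) + w(y)\<close> on a vector space,
  in closed form: \<open>g\<^sub>y(u,v) = dF(u) dF(v) + F(y) Hess(sqrt H)(u,v)\<close>, the derivatives being taken at
  \<open>y\<close>.  It is meant for \<open>y \<noteq> 0\<close>.\<close>
definition randers_tensor ::
  "('e \<Rightarrow> 'e \<Rightarrow> real) \<Rightarrow> ('e \<Rightarrow> real) \<Rightarrow> 'e \<Rightarrow> 'e \<Rightarrow> 'e \<Rightarrow> real" where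
  "randers_tensor H w y u v = (let a = sqrt (H y y) in
     (H y u / a + w u) * (H y v / a + w v) + (a + w y) * (H u v / a - H y u * H y v / a ^ 3))"

text \<open>Polynomial form in the norm \<open>a\<close> of \<open>y\<close> and its inverse \<open>i\<close>, which is convenient to differentiate.\<close>
lemma randers_tensor_alt:
  assumes "sqrt (H y y) = a" "inverse a = i"
  shows "randers_tensor H w y u v = (H y u * i + w u) * (H y v * i + w v)
    + (a + w y) * (H u v * i - H y u * H y v * i ^ 3)"
  using assms by (auto simp: randers_tensor_def Let_def divide_inverse power_inverse)

lemma bilinear_cauchy_schwarz:
  fixes H :: "'e::real_vector \<Rightarrow> 'e \<Rightarrow> real"
  assumes H: "bilinear H" and sym: "\<And>u v. H u v = H v u" and pos: "\<And>u. u \<noteq> 0 \<Longrightarrow> 0 < H u u"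
  shows "(H u v)\<^sup>2 \<le> H u u * H v v"
    and "v \<noteq> 0 \<Longrightarrow> (H u v)\<^sup>2 = H u u * H v v \<Longrightarrow> \<exists>k. u = k *\<^sub>R v"
proof -
  note bl = bilinear_lsub[OF H] bilinear_rsub[OF H] bilinear_lmul[OF H] bilinear_rmul[OF H]
    bilinear_lzero[OF H] bilinear_rzero[OF H]
  have nonneg: "0 \<le> H u u" for u using pos[of u] by (cases "u = 0") (auto simp: bl)
  have key: "H (u - (H u v / H v v) *\<^sub>R v) (u - (H u v / H v v) *\<^sub>R v) * H v v
      = H u u * H v v - (H u v)\<^sup>2" if "v \<noteq> 0"
    using pos[OF that] sym[of v u] by (simp add: bl field_simps power2_eq_square)
  show "(H u v)\<^sup>2 \<le> H u u * H v v"
  proof (cases "v = 0")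
    case False
    have "0 \<le> H u u * H v v - (H u v)\<^sup>2"
      unfolding key[OF False, symmetric] by (intro mult_nonneg_nonneg nonneg)
    then show ?thesis by simp
  qed (simp add: bl)
  assume v: "v \<noteq> 0" and "(H u v)\<^sup>2 = H u u * H v v"
  then have "H (u - (H u v / H v v) *\<^sub>R v) (u - (H u v / H v v) *\<^sub>R v) = 0"
    using key[OF v] pos[OF v] by simp
  then have "u - (H u v / H v v) *\<^sub>R v = 0" using pos by fastforce
  then show "\<exists>k. u = k *\<^sub>R v" by (intro exI[of _ "H u v / H v v"]) simp
qed

lemma randers_square_deriv:
  fixes H :: "'e::real_vector \<Rightarrow> 'e \<Rightarrow> real"
  assumes H: "bilinear H" and sym: "\<And>u v. H u v = H v u" and pos: "\<And>u. u \<noteq> 0 \<Longrightarrow> 0 < H u u"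
    and w: "linear w" and Y: "Y \<noteq> 0"
  shows "((\<lambda>t. (sqrt (H (Y + t *\<^sub>R v) (Y + t *\<^sub>R v)) + w (Y + t *\<^sub>R v))\<^sup>2 / 2) has_real_derivative
     (sqrt (H Y Y) + w Y) * (H Y v / sqrt (H Y Y) + w v)) (at 0)"
proof -
  have "H (Y + t *\<^sub>R v) (Y + t *\<^sub>R v) = H Y Y + 2 * t * H Y v + t\<^sup>2 * H v v" for t
    using sym[of v Y] by (simp add: bilinear_ladd[OF H] bilinear_radd[OF H] bilinear_lmul[OF H]
        bilinear_rmul[OF H] power2_eq_square algebra_simps)
  moreover have "w (Y + t *\<^sub>R v) = w Y + t * w v" for t
    by (simp add: linear_add[OF w] linear_scale[OF w])
  ultimately show ?thesis
    using pos[OF Y] by (auto intro!: derivative_eq_intros simp: field_simps)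
qed

lemma fundamental_tensor_eq_randers_tensor:
  fixes H :: "'e::real_normed_vector \<Rightarrow> 'e \<Rightarrow> real"
  assumes H: "bilinear H" and sym: "\<And>u v. H u v = H v u" and pos: "\<And>u. u \<noteq> 0 \<Longrightarrow> 0 < H u u"
    and w: "linear w" and y: "y \<noteq> 0"
  shows "deriv (\<lambda>s. deriv (\<lambda>t. (sqrt (H (y + s *\<^sub>R u + t *\<^sub>R v) (y + s *\<^sub>R u + t *\<^sub>R v))
      + w (y + s *\<^sub>R u + t *\<^sub>R v))\<^sup>2 / 2) 0) 0 = randers_tensor H w y u v"
proof -
  define a i where "a s = sqrt (H (y + s *\<^sub>R u) (y + s *\<^sub>R u))" and "i s = inverse (a s)" for s
  define f where "f s = (a s + w (y + s *\<^sub>R u)) * (H (y + s *\<^sub>R u) v * i s + w v)" for s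
  have "((\<lambda>s. y + s *\<^sub>R u) \<longlongrightarrow> y + 0 *\<^sub>R u) (nhds (0::real))"
    by (intro tendsto_intros filterlim_ident)
  then have "\<forall>\<^sub>F s in nhds (0::real). y + s *\<^sub>R u \<noteq> 0"
    using y by (intro tendsto_imp_eventually_ne) auto
  then have ev: "\<forall>\<^sub>F s in nhds (0::real). deriv (\<lambda>t. (sqrt (H (y + s *\<^sub>R u + t *\<^sub>R v)
      (y + s *\<^sub>R u + t *\<^sub>R v)) + w (y + s *\<^sub>R u + t *\<^sub>R v))\<^sup>2 / 2) 0 = f s"
    unfolding f_def a_def i_def divide_inverse[symmetric]
    by eventually_elim (intro DERIV_imp_deriv randers_square_deriv H sym pos w)
  have Hu: "H (y + s *\<^sub>R u) (y + s *\<^sub>R u) = H y y + 2 * s * H y u + s\<^sup>2 * H u u" for s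
    using sym[of u y] by (simp add: bilinear_ladd[OF H] bilinear_radd[OF H] bilinear_lmul[OF H]
        bilinear_rmul[OF H] power2_eq_square algebra_simps)
  have wu: "w (y + s *\<^sub>R u) = w y + s * w u" "H (y + s *\<^sub>R u) v = H y v + s * H u v" for s
    by (simp_all add: linear_add[OF w] linear_scale[OF w] bilinear_ladd[OF H] bilinear_lmul[OF H])
  have pos0: "0 < a 0" "a 0 * i 0 = 1" using pos[OF y] by (simp_all add: a_def i_def)
  have da: "(a has_real_derivative H y u * i 0) (at 0)"
    unfolding a_def Hu i_def using pos[OF y]
    by (auto intro!: derivative_eq_intros simp: field_simps)
  have "(i has_real_derivative - (H y u * i 0) * (i 0)\<^sup>2) (at 0)"
    unfolding i_def using pos0
    by (auto intro!: derivative_eq_intros da simp: i_def power2_eq_square)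
  with da have "(f has_real_derivative (H y u * i 0 + w u) * (H y v * i 0 + w v)
      + (a 0 + w y) * (H u v * i 0 - H y u * H y v * i 0 ^ 3)) (at 0)"
    unfolding f_def wu
    by (auto intro!: derivative_eq_intros simp: algebra_simps power2_eq_square power3_eq_cube)
  also have "(H y u * i 0 + w u) * (H y v * i 0 + w v)
      + (a 0 + w y) * (H u v * i 0 - H y u * H y v * i 0 ^ 3) = randers_tensor H w y u v"
    by (rule randers_tensor_alt[symmetric]) (simp_all add: a_def i_def)
  finally have "deriv f 0 = randers_tensor H w y u v"
    by (rule DERIV_imp_deriv)
  then show ?thesis using deriv_cong_ev[OF ev refl] by simp
qed

lemma
  fixes H :: "'e::real_vector \<Rightarrow> 'e \<Rightarrow> real"
  assumes H: "bilinear H" and sym: "\<And>u v. H u v = H v u" and w: "linear w"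
  shows bilinear_randers_tensor: "bilinear (randers_tensor H w y)"
    and randers_tensor_sym: "randers_tensor H w y u v = randers_tensor H w y v u"
proof -
  show *: "randers_tensor H w y u v = randers_tensor H w y v u" for u v
    using sym[of u v] by (simp add: randers_tensor_def Let_def mult.commute)
  have **: "linear (randers_tensor H w y u)" for u
    by (rule linearI) (simp_all add: randers_tensor_def Let_def bilinear_radd[OF H]
        bilinear_rmul[OF H] linear_add[OF w] linear_scale[OF w] add_divide_distrib algebra_simps)
  show "bilinear (randers_tensor H w y)"
  proof (unfold bilinear_def, intro conjI allI **)
    fix v
    have "(\<lambda>u. randers_tensor H w y u v) = randers_tensor H w y v" using * by blast
    then show "linear (\<lambda>u. randers_tensor H w y u v)" using ** by simp
  qed
qed

lemma
  fixes H :: "'e::real_vector \<Rightarrow> 'e \<Rightarrow> real"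
  assumes H: "bilinear H" and sym: "\<And>u v. H u v = H v u" and pos: "\<And>u. u \<noteq> 0 \<Longrightarrow> 0 < H u u"
    and y: "y \<noteq> 0"
  shows randers_tensor_left: "randers_tensor H w y y v
      = (sqrt (H y y) + w y) * (H y v / sqrt (H y y) + w v)"
    and randers_tensor_diag: "randers_tensor H w y y y = (sqrt (H y y) + w y)\<^sup>2"
proof -
  define a where "a = sqrt (H y y)"
  have a: "a > 0" "H y y = a * a" using pos[OF y] by (simp_all add: a_def)
  show "randers_tensor H w y y v = (sqrt (H y y) + w y) * (H y v / sqrt (H y y) + w v)"
    "randers_tensor H w y y y = (sqrt (H y y) + w y)\<^sup>2"
    unfolding randers_tensor_def a_def[symmetric] Let_def using a
    by (simp_all add: field_simps power3_eq_cube power2_eq_square)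
qed

text \<open>With \<open>F(y) > 0\<close>, both summands of the tensor are nonnegative on \<open>(u,u)\<close>. The second vanishes only
  for \<open>u = k y\<close>, and then the first is \<open>k\<^sup>2 F(y)\<^sup>2\<close>.\<close>
lemma randers_tensor_pos:
  fixes H :: "'e::real_vector \<Rightarrow> 'e \<Rightarrow> real"
  assumes H: "bilinear H" and sym: "\<And>u v. H u v = H v u" and pos: "\<And>u. u \<noteq> 0 \<Longrightarrow> 0 < H u u"
    and w: "linear w" and small: "\<bar>w y\<bar> < sqrt (H y y)" and y: "y \<noteq> 0" and u: "u \<noteq> 0"
  shows "0 < randers_tensor H w y u u"
proof -
  define a where "a = sqrt (H y y)"
  have a: "a > 0" "H y y = a * a" using pos[OF y] by (simp_all add: a_def)
  have F: "0 < a + w y" using small by (simp add: a_def)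
  have eq: "randers_tensor H w y u u
      = (H y u / a + w u)\<^sup>2 + (a + w y) / a ^ 3 * (H u u * H y y - (H u y)\<^sup>2)"
  proof -
    define i where "i = inverse a"
    have i: "a * i = 1" and ai: "(a + w y) / a ^ 3 = (a + w y) * i ^ 3"
      using a by (simp_all add: i_def divide_inverse power_inverse)
    show ?thesis
      unfolding randers_tensor_alt[of H, OF a_def[symmetric] i_def[symmetric]] ai
      unfolding divide_inverse i_def[symmetric] sym[of u y] a(2)
      using i by algebra
  qed
  have cs: "0 \<le> H u u * H y y - (H u y)\<^sup>2"
    using bilinear_cauchy_schwarz(1)[OF H sym pos] by simp
  show ?thesis
  proof (cases "H u u * H y y - (H u y)\<^sup>2 = 0")
    case True
    then obtain k where k: "u = k *\<^sub>R y"
      using bilinear_cauchy_schwarz(2)[OF H sym pos y, of u] by auto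
    have "H y u / a + w u = k * (a + w y)"
      using a by (simp add: k bilinear_rmul[OF H] linear_scale[OF w] field_simps)
    moreover have "k \<noteq> 0" using u k by auto
    ultimately show ?thesis unfolding eq using True F by simp
  next
    case False
    then show ?thesis unfolding eq using cs F a by (intro add_nonneg_pos) simp_all
  qed
qed

text \<open>The second claim is \<open>C\<^sub>y(z, y, v) = 0\<close> for the Cartan tensor, a consequence of homogeneity. Only
  the base point varies in the derivative; the first argument stays equal to \<open>y\<close>.\<close>
lemma
  fixes H :: "'e::euclidean_space \<Rightarrow> 'e \<Rightarrow> real"
  assumes H: "bilinear H" and sym: "\<And>u v. H u v = H v u" and pos: "\<And>u. u \<noteq> 0 \<Longrightarrow> 0 < H u u"
    and w: "linear w" and y: "y \<noteq> 0"
  shows randers_tensor_fibre_differentiable: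
      "(\<lambda>z. randers_tensor H w z u v) differentiable (at y)"
    and randers_tensor_cartan:
      "frechet_derivative (\<lambda>z. randers_tensor H w z y v) (at y) z = 0"
proof -
  have Hy: "0 < H y y" using pos[OF y] .
  have lw: "(w has_derivative w) (at y)"
    using w by (simp add: bounded_linear_imp_has_derivative linear_conv_bounded_linear)
  have lH: "((\<lambda>z. H z u) has_derivative (\<lambda>z. H z u)) (at y)" for u
    using H by (intro bounded_linear_imp_has_derivative)
      (simp add: bilinear_def linear_conv_bounded_linear)
  have Hzy: "(\<lambda>z. H z y) = H y" using sym by blast
  have lHy: "((\<lambda>z. H z y) has_derivative H y) (at y)"
    using lH[of y] unfolding Hzy .
  have "((\<lambda>z. H z z) has_derivative (\<lambda>z. H y z + H z y)) (at y)"
    using H unfolding bilinear_conv_bounded_bilinear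
    by (rule bounded_bilinear.FDERIV) auto
  then have qH: "((\<lambda>z. H z z) has_derivative (\<lambda>z. 2 * H y z)) (at y)"
    using fun_cong[OF Hzy] by (auto elim!: has_derivative_eq_rhs)
  define a i where "a z = sqrt (H z z)" and "i z = inverse (a z)" for z
  have pos0: "0 < a y" "a y * i y = 1" "H y y = a y * a y"
    using Hy by (simp_all add: a_def i_def)
  have da: "(a has_derivative (\<lambda>z. H y z * i y)) (at y)"
    unfolding a_def[abs_def] i_def using Hy
    by (auto intro!: derivative_eq_intros qH simp: field_simps)
  have di: "(i has_derivative (\<lambda>z. - (H y z * i y) * (i y)\<^sup>2)) (at y)"
    unfolding i_def[abs_def] using pos0
    by (auto intro!: derivative_eq_intros da simp: i_def power2_eq_square)
  note alt = randers_tensor_alt[of H, OF a_def[symmetric] i_def[symmetric]]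
  show "(\<lambda>z. randers_tensor H w z u v) differentiable (at y)"
    unfolding alt
    using lw lH da di by (intro derivative_intros) (auto simp: differentiable_def)
  have "((\<lambda>z. randers_tensor H w z y v) has_derivative (\<lambda>z.
      (H y z * i y + H y y * (- (H y z * i y) * (i y)\<^sup>2)) * (H y v * i y + w v)
      + (H y y * i y + w y) * (H z v * i y + H y v * (- (H y z * i y) * (i y)\<^sup>2))
      + (H y z * i y + w z) * (H y v * i y - H y y * H y v * i y ^ 3)
      + (a y + w y) * (H y v * (- (H y z * i y) * (i y)\<^sup>2) - H y z * H y v * i y ^ 3
         - H y y * H z v * i y ^ 3
         - H y y * H y v * (3 * (i y)\<^sup>2 * (- (H y z * i y) * (i y)\<^sup>2))))) (at y)"
    unfolding alt
    by (auto intro!: derivative_eq_intros lw lH lHy da di simp: algebra_simps power2_eq_square power3_eq_cube)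
  also have "(\<lambda>z.
      (H y z * i y + H y y * (- (H y z * i y) * (i y)\<^sup>2)) * (H y v * i y + w v)
      + (H y y * i y + w y) * (H z v * i y + H y v * (- (H y z * i y) * (i y)\<^sup>2))
      + (H y z * i y + w z) * (H y v * i y - H y y * H y v * i y ^ 3)
      + (a y + w y) * (H y v * (- (H y z * i y) * (i y)\<^sup>2) - H y z * H y v * i y ^ 3
         - H y y * H z v * i y ^ 3
         - H y y * H y v * (3 * (i y)\<^sup>2 * (- (H y z * i y) * (i y)\<^sup>2)))) = (\<lambda>_. 0)"
    using pos0(2) unfolding pos0(3) by (intro ext) algebra
  finally have "((\<lambda>z. randers_tensor H w z y v) has_derivative (\<lambda>_. 0)) (at y)" .
  then show "frechet_derivative (\<lambda>z. randers_tensor H w z y v) (at y) z = 0"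
    using frechet_derivative_at by metis
qed

section \<open>Chern and Levi-Civita connections of a Randers metric in coordinates\<close>

lemma differentiable_cong_open:
  assumes "f differentiable (at p)" "open S" "p \<in> S" "\<And>q. q \<in> S \<Longrightarrow> f q = g q"
  shows "g differentiable (at p)"
  using assms has_derivative_transform_within_open unfolding differentiable_def by blast

lemma ex1_metric_derivative_connection:
  fixes g :: "'e::euclidean_space \<Rightarrow> 'e \<Rightarrow> 'e \<Rightarrow> real"
  assumes S: "open S" "p \<in> S" and bil: "\<And>q. q \<in> S \<Longrightarrow> bilinear (g q)"
    and sym: "\<And>q u v. q \<in> S \<Longrightarrow> g q u v = g q v u"
    and pos: "\<And>u. u \<noteq> 0 \<Longrightarrow> 0 < g p u u"
    and d: "\<And>u v. (\<lambda>q. g q u v) differentiable (at p)"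
    and C1: "\<And>v w. linear (\<lambda>u. C u v w)" and C: "\<And>u. bilinear (C u)"
    and Csym: "\<And>u v w. C u v w = C u w v" and C0: "\<And>z w. C z y w = 0"
  shows "\<exists>!\<Gamma>. bilinear \<Gamma> \<and> (\<forall>u v. \<Gamma> u v = \<Gamma> v u) \<and>
    (\<forall>u v w. frechet_derivative (\<lambda>q. g q v w) (at p) u
       = g p (\<Gamma> u v) w + g p v (\<Gamma> u w) + C (\<Gamma> u y) v w)"
proof (rule almost_compatible_connection_ex1)
  show "linear (\<lambda>u. frechet_derivative (\<lambda>q. g q v w) (at p) u)" for v w
    using linear_frechet_derivative[OF d] by simp
  show "bilinear (\<lambda>v w. frechet_derivative (\<lambda>q. g q v w) (at p) u)" for u
    by (rule bilinear_frechet_derivative[OF S bil d])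
  show "frechet_derivative (\<lambda>q. g q v w) (at p) u = frechet_derivative (\<lambda>q. g q w v) (at p) u"
    for u v w
    by (rule fun_cong[OF frechet_derivative_transform_within_open[OF d S sym]])
qed (use S bil sym pos C1 C Csym C0 in auto)

lemma ex1_levi_civita:
  fixes g :: "'e::euclidean_space \<Rightarrow> 'e \<Rightarrow> 'e \<Rightarrow> real"
  assumes "open S" "p \<in> S" and "\<And>q. q \<in> S \<Longrightarrow> bilinear (g q)"
    and "\<And>q u v. q \<in> S \<Longrightarrow> g q u v = g q v u"
    and "\<And>u. u \<noteq> 0 \<Longrightarrow> 0 < g p u u"
    and "\<And>u v. (\<lambda>q. g q u v) differentiable (at p)"
  shows "\<exists>!\<Gamma>. bilinear \<Gamma> \<and> (\<forall>u v. \<Gamma> u v = \<Gamma> v u) \<and>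
    (\<forall>u v w. frechet_derivative (\<lambda>q. g q v w) (at p) u = g p (\<Gamma> u v) w + g p v (\<Gamma> u w))"
  using ex1_metric_derivative_connection[OF assms, of "\<lambda>_ _ _. 0" 0]
  by (simp add: bilinear_def linear_zero)

text \<open>In coordinates and for \<open>n\<close> orthogonal to \<open>y\<close>: the Chern connection \<open>N\<close> of the Randers metric and the
  Levi-Civita connection \<open>L\<close> differ on \<open>(y,y)\<close>, in the direction of \<open>n\<close>, by the magnetic term
  \<open>|y| d\<omega>(y,n)\<close>. The function \<open>T\<close> is the fundamental tensor, prescribed only over \<open>S\<close> and off the
  zero section.\<close>
lemma randers_chern_diagonal:
  fixes H :: "'e::euclidean_space \<Rightarrow> 'e \<Rightarrow> 'e \<Rightarrow> real" and w :: "'e \<Rightarrow> 'e \<Rightarrow> real"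
  assumes S: "open S" "p \<in> S"
    and H: "\<And>q. q \<in> S \<Longrightarrow> bilinear (H q)" and sym: "\<And>q u v. q \<in> S \<Longrightarrow> H q u v = H q v u"
    and pos: "\<And>q u. q \<in> S \<Longrightarrow> u \<noteq> 0 \<Longrightarrow> 0 < H q u u"
    and w: "\<And>q. q \<in> S \<Longrightarrow> linear (w q)"
    and dH: "\<And>u v. (\<lambda>q. H q u v) differentiable (at p)"
    and dw: "\<And>u. (\<lambda>q. w q u) differentiable (at p)"
    and small: "\<And>y. y \<noteq> 0 \<Longrightarrow> \<bar>w p y\<bar> < sqrt (H p y y)"
    and T: "\<And>q z u v. q \<in> S \<Longrightarrow> z \<noteq> 0 \<Longrightarrow> T q z u v = randers_tensor (H q) (w q) z u v"
    and y: "y \<noteq> 0" and n: "H p n y = 0"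
    and L: "L = (THE \<Gamma>. bilinear \<Gamma> \<and> (\<forall>u v. \<Gamma> u v = \<Gamma> v u) \<and>
      (\<forall>u v w. frechet_derivative (\<lambda>q. H q v w) (at p) u = H p (\<Gamma> u v) w + H p v (\<Gamma> u w)))"
    and N: "N = (THE \<Gamma>. bilinear \<Gamma> \<and> (\<forall>u v. \<Gamma> u v = \<Gamma> v u) \<and>
      (\<forall>u v w. frechet_derivative (\<lambda>q. T q y v w) (at p) u =
         T p y (\<Gamma> u v) w + T p y v (\<Gamma> u w)
           + frechet_derivative (\<lambda>z. T p z v w) (at y) (\<Gamma> u y)))"
  shows "H p n (N y y) = H p n (L y y) + sqrt (H p y y) *
    (frechet_derivative (\<lambda>q. w q n) (at p) y - frechet_derivative (\<lambda>q. w q y) (at p) n)"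
proof -
  note Hp = H[OF S(2)] sym[OF S(2)] pos[OF S(2)] and wp = w[OF S(2)]
  define E where "E v w = frechet_derivative (\<lambda>q. H q v w) (at p)" for v w
  define W where "W v = frechet_derivative (\<lambda>q. w q v) (at p)" for v
  have E: "((\<lambda>q. H q u v) has_derivative E u v) (at p)" for u v
    unfolding E_def using dH frechet_derivative_works by blast
  have W: "((\<lambda>q. w q u) has_derivative W u) (at p)" for u
    unfolding W_def using dw frechet_derivative_works by blast

  from theI'[OF ex1_levi_civita[OF S H sym Hp(3) dH], folded L] have Lsym: "L u v = L v u"
    and Lc: "E v w u = H p (L u v) w + H p v (L u w)" for u v w
    unfolding E_def by blast+
  have Ldiag: "H p (L y y) v = E y v y - E y y v / 2" for v
    using connection_diagonal[of "H p" L "\<lambda>_ _ _. 0" y "\<lambda>u v w. E v w u" v] Hp(2) Lsym Lc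
    by simp

  \<comment> \<open>Derivatives in the base point, with \<open>y\<close> fixed.\<close>
  define a i where "a q = sqrt (H q y y)" and "i q = inverse (a q)" for q
  have a: "0 < a p" "a p * i p = 1" "H p y y = a p * a p"
    using Hp(3)[OF y] by (simp_all add: a_def i_def)
  have da: "(a has_derivative (\<lambda>u. E y y u * i p / 2)) (at p)"
    unfolding a_def[abs_def] i_def using Hp(3)[OF y]
    by (auto intro!: derivative_eq_intros E simp: field_simps)
  have di: "(i has_derivative (\<lambda>u. - (E y y u * i p / 2) * (i p)\<^sup>2)) (at p)"
    unfolding i_def[abs_def] using a
    by (auto intro!: derivative_eq_intros da simp: i_def power2_eq_square)
  have alt: "randers_tensor (H q) (w q) y u v = (H q y u * i q + w q u) * (H q y v * i q + w q v)
    + (a q + w q y) * (H q u v * i q - H q y u * H q y v * i q ^ 3)" for q u v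
    by (rule randers_tensor_alt) (simp_all add: a_def i_def)
  have left: "randers_tensor (H q) (w q) y y v = (a q + w q y) * (H q y v * i q + w q v)"
    if "q \<in> S" for q v
    using randers_tensor_left[OF H sym pos y, OF that that that] 
    by (simp add: a_def i_def divide_inverse)
  have diag: "randers_tensor (H q) (w q) y y y = (a q + w q y)\<^sup>2" if "q \<in> S" for q
    using randers_tensor_diag[OF H sym pos y, OF that that that] by (simp add: a_def)
  have dR: "(\<lambda>q. randers_tensor (H q) (w q) y u v) differentiable (at p)" for u v
    unfolding alt using dH dw da di by (intro derivative_intros) (auto simp: differentiable_def)
  have Teq: "randers_tensor (H q) (w q) y u v = T q y u v" if "q \<in> S" for q u v
    using T[OF that y] by simp
  have dT: "(\<lambda>q. T q y u v) differentiable (at p)" for u v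
    by (rule differentiable_cong_open[OF dR S Teq])
  have F: "0 < a p + w p y" using small[OF y] by (simp add: a_def)

  \<comment> \<open>Derivatives along the fibre, that is, the Cartan tensor.\<close>
  have Y: "open (- {0 :: 'e})" "y \<in> - {0}" using y by auto
  have TFeq: "randers_tensor (H p) (w p) z u v = T p z u v" if "z \<in> - {0}" for z u v
    using T[OF S(2)] that by simp
  have dTF: "(\<lambda>z. T p z u v) differentiable (at y)" for u v
    by (rule differentiable_cong_open[OF randers_tensor_fibre_differentiable[OF Hp wp y] Y TFeq])
  define C where "C u v w = frechet_derivative (\<lambda>z. T p z v w) (at y) u" for u v w
  have C1: "linear (\<lambda>u. C u v w)" for v w
    unfolding C_def using linear_frechet_derivative[OF dTF] by simp
  have TF: "bilinear (T p z)" if "z \<in> - {0}" for z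
  proof -
    have "randers_tensor (H p) (w p) z = T p z" by (intro ext TFeq that)
    then show ?thesis using bilinear_randers_tensor[OF Hp(1,2) wp, of z] by simp
  qed
  have Csym: "C u v w' = C u w' v" for u v w'
  proof -
    have "T p z v w' = T p z w' v" if "z \<in> - {0}" for z
      unfolding TFeq[OF that, symmetric] by (rule randers_tensor_sym[OF Hp(1,2) wp])
    then show ?thesis
      unfolding C_def by (intro fun_cong[OF frechet_derivative_transform_within_open[OF dTF Y]])
  qed
  have Cbil: "bilinear (C u)" for u
    unfolding C_def[abs_def] by (rule bilinear_frechet_derivative[OF Y TF dTF])
  have C0: "C z y v = 0" for z v
  proof -
    have "C z y v = frechet_derivative (\<lambda>z. randers_tensor (H p) (w p) z y v) (at y) z"
      unfolding C_def
      by (intro fun_cong[OF frechet_derivative_transform_within_open[OF dTF Y]] TFeq[symmetric])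
    then show ?thesis using randers_tensor_cartan[OF Hp wp y] by simp
  qed
  have "\<exists>!\<Gamma>. bilinear \<Gamma> \<and> (\<forall>u v. \<Gamma> u v = \<Gamma> v u) \<and>
      (\<forall>u v w. frechet_derivative (\<lambda>q. T q y v w) (at p) u =
         T p y (\<Gamma> u v) w + T p y v (\<Gamma> u w) + C (\<Gamma> u y) v w)"
  proof (rule ex1_metric_derivative_connection[OF S _ _ _ dT C1 Cbil Csym C0])
    fix q assume q: "q \<in> S"
    show "bilinear (\<lambda>u v. T q y u v)"
    proof -
      have "randers_tensor (H q) (w q) y = T q y" by (intro ext Teq q)
      then show ?thesis using bilinear_randers_tensor[OF H sym w, OF q q q, of y] by simp
    qed
    show "T q y u v = T q y v u" for u v
      unfolding Teq[OF q, symmetric] by (rule randers_tensor_sym[OF H sym w, OF q q q])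
  next
    show "0 < T p y u u" if "u \<noteq> 0" for u
      using randers_tensor_pos[OF Hp wp small[OF y] y that] T[OF S(2) y] by simp
  qed
  from theI'[OF this[unfolded C_def], folded N] have Nsym: "N u v = N v u"
    and Nc: "frechet_derivative (\<lambda>q. T q y v w) (at p) u =
         T p y (N u v) w + T p y v (N u w) + C (N u y) v w" for u v w
    unfolding C_def by blast+
  have Tsym: "T p y u v = T p y v u" for u v
    unfolding Teq[OF S(2), symmetric] by (rule randers_tensor_sym[OF Hp(1,2) wp])
  define \<Gamma> where "\<Gamma> = N y y"
  have Ndiag: "T p y \<Gamma> v = frechet_derivative (\<lambda>q. T q y y v) (at p) y
      - frechet_derivative (\<lambda>q. T q y y y) (at p) v / 2" for v
    unfolding \<Gamma>_def
    by (rule connection_diagonal[where C = C and D = "\<lambda>u v w. frechet_derivative (\<lambda>q. T q y v w) (at p) u"])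
      (fact Tsym Nsym C0 Nc)+
  have D1: "frechet_derivative (\<lambda>q. T q y y v) (at p) u
      = (E y y u * i p / 2 + W y u) * (H p y v * i p + w p v)
        + (a p + w p y) * (E y v u * i p + H p y v * (- (E y y u * i p / 2) * (i p)\<^sup>2) + W v u)"
    for u v
  proof -
    have "((\<lambda>q. (a q + w q y) * (H q y v * i q + w q v)) has_derivative
      (\<lambda>u. (E y y u * i p / 2 + W y u) * (H p y v * i p + w p v)
        + (a p + w p y) * (E y v u * i p + H p y v * (- (E y y u * i p / 2) * (i p)\<^sup>2) + W v u)))
      (at p)"
      by (auto intro!: derivative_eq_intros da di E W simp: algebra_simps add_divide_distrib)
    then have "((\<lambda>q. T q y y v) has_derivative
      (\<lambda>u. (E y y u * i p / 2 + W y u) * (H p y v * i p + w p v)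
        + (a p + w p y) * (E y v u * i p + H p y v * (- (E y y u * i p / 2) * (i p)\<^sup>2) + W v u)))
      (at p)"
      by (rule has_derivative_transform_within_open[OF _ S]) (simp add: left Teq[symmetric])
    from frechet_derivative_at[OF this, symmetric] show ?thesis by simp
  qed
  have aai: "a p * a p * i p = a p" and aaiii: "a p * a p * i p ^ 3 = i p"
    using a(1) by (simp_all add: i_def field_simps power3_eq_cube)
  have D2: "frechet_derivative (\<lambda>q. T q y y y) (at p) u
      = 2 * (a p + w p y) * (E y y u * i p / 2 + W y u)" for u
  proof -
    have "a p * a p * (- (E y y u * i p / 2) * (i p)\<^sup>2) = - (E y y u * i p / 2)"
    proof -
      have "a p * a p * (i p)\<^sup>2 = 1"
        using a(1) by (simp add: i_def field_simps power2_eq_square)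
      then have "- (E y y u * i p / 2) * (a p * a p * (i p)\<^sup>2) = - (E y y u * i p / 2)" by simp
      then show ?thesis by (simp only: mult_ac)
    qed
    note eq = this
    show ?thesis unfolding D1 a(3) aai eq by (simp add: algebra_simps)
  qed
  have gT: "T p y \<Gamma> v = (H p y \<Gamma> * i p + w p \<Gamma>) * (H p y v * i p + w p v)
    + (a p + w p y) * (H p \<Gamma> v * i p - H p y \<Gamma> * H p y v * i p ^ 3)" for v
    unfolding Teq[OF S(2), symmetric] alt ..
  \<comment> \<open>Testing \<open>Ndiag\<close> against \<open>y\<close> gives \<open>dF(\<Gamma>) = \<partial>\<^sub>y F\<close> (\<open>F\<close> is constant along its geodesics); this cancels the
    terms with \<open>w p n\<close> when \<open>Ndiag\<close> is tested against \<open>n\<close>.\<close>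
  have "(a p + w p y) * (H p y \<Gamma> * i p + w p \<Gamma>) = (a p + w p y) * (E y y y * i p / 2 + W y y)"
  proof -
    have eq: "H p y \<Gamma> * (a p * a p) * i p ^ 3 = H p y \<Gamma> * i p"
      using aaiii by (simp add: mult.assoc)
    have "T p y \<Gamma> y = (a p + w p y) * (H p y \<Gamma> * i p + w p \<Gamma>)"
      unfolding gT Hp(2)[of \<Gamma> y] a(3) aai eq by (simp add: algebra_simps)
    moreover have "t = f * b" if "t = d - d / 2" "d = 2 * f * b" for t d f b :: real
      using that by simp
    ultimately show ?thesis using Ndiag[of y] D2[of y] by metis
  qed
  then have FG: "H p y \<Gamma> * i p + w p \<Gamma> = E y y y * i p / 2 + W y y"
    using F by simp
  have yn: "H p y n = 0" using n Hp(2) by simp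
  have "(a p + w p y) * (H p \<Gamma> n * i p)
      = (a p + w p y) * (E y n y * i p - E y y n * i p / 2 + (W n y - W y n))"
  proof -
    have "F * x = F * (e - d / 2 + (c - b))"
      if "A * r + F * x = A * r + F * (e + c) - 2 * F * (d / 2 + b) / 2" for A r F x e d c b :: real
      using that by (simp add: field_simps)
    moreover have "(E y y y * i p / 2 + W y y) * w p n + (a p + w p y) * (H p \<Gamma> n * i p)
      = (E y y y * i p / 2 + W y y) * w p n + (a p + w p y) * (E y n y * i p + W n y)
        - 2 * (a p + w p y) * (E y y n * i p / 2 + W y n) / 2"
      using gT[of n] unfolding Ndiag[of n] D2 D1 yn FG by simp
    ultimately show ?thesis by blast
  qed
  then have "H p \<Gamma> n * i p = E y n y * i p - E y y n * i p / 2 + (W n y - W y n)"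
    using F by simp
  then have "H p \<Gamma> n = H p (L y y) n + a p * (W n y - W y n)"
  proof -
    assume eq: "H p \<Gamma> n * i p = E y n y * i p - E y y n * i p / 2 + (W n y - W y n)"
    have "H p \<Gamma> n = a p * (H p \<Gamma> n * i p)" using a(1) by (simp add: i_def)
    also have "\<dots> = E y n y - E y y n / 2 + a p * (W n y - W y n)"
      unfolding eq using a(1) by (simp add: i_def field_simps)
    finally show ?thesis unfolding Ldiag .
  qed
  then show ?thesis
    unfolding \<Gamma>_def W_def a_def Hp(2)[of n] .
qed

section \<open>Second order comparison of defining functions\<close>

lemma C_k_on_2D:
  assumes "C_k_on 2 f S" "q \<in> S"
  shows "(f has_derivative frechet_derivative f (at q)) (at q)"
    and "((\<lambda>q. frechet_derivative f (at q) v) has_derivative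
      (\<lambda>u. second_derivative f q u v)) (at q)"
    and "isCont (\<lambda>q. frechet_derivative f (at q) v) q"
proof -
  show "(f has_derivative frechet_derivative f (at q)) (at q)"
    using assms by (simp add: numeral_2_eq_2 frechet_derivative_works)
  show *: "((\<lambda>q. frechet_derivative f (at q) v) has_derivative
      (\<lambda>u. second_derivative f q u v)) (at q)"
    using assms unfolding second_derivative_def
    by (simp add: numeral_2_eq_2 frechet_derivative_works[symmetric])
  then show "isCont (\<lambda>q. frechet_derivative f (at q) v) q"
    by (rule has_derivative_continuous)
qed

lemma eventually_line_in_open:
  fixes p v :: "'v::real_normed_vector"
  assumes "open S" "p \<in> S"
  shows "\<forall>\<^sub>F t in at_right (0::real). p + t *\<^sub>R v \<in> S"
proof -
  have "((\<lambda>t. p + t *\<^sub>R v) \<longlongrightarrow> p + 0 *\<^sub>R v) (at_right (0::real))"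
    by (intro tendsto_intros)
  then show ?thesis using topological_tendstoD[OF _ assms(1)] assms(2) by fastforce
qed

lemma isCont_tendsto_nhds: "isCont f p \<Longrightarrow> (f \<longlongrightarrow> f p) (nhds p)"
  by (simp add: isCont_def tendsto_at_iff_tendsto_nhds)

lemma taylor2_line:
  fixes f :: "'v::real_normed_vector \<Rightarrow> real"
  assumes f: "C_k_on 2 f S" and S: "open S" "p \<in> S"
    and f0: "f p = 0" and df: "frechet_derivative f (at p) v = 0"
  shows "((\<lambda>t. f (p + t *\<^sub>R v) / t\<^sup>2) \<longlongrightarrow> second_derivative f p v v / 2) (at_right 0)"
proof (rule lhopital_right_0)
  have line: "((\<lambda>t. p + t *\<^sub>R v) has_derivative (\<lambda>h. h *\<^sub>R v)) (at t)" for t :: real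
    by (auto intro!: derivative_eq_intros)
  have D: "((\<lambda>t. f (p + t *\<^sub>R v)) has_real_derivative
      frechet_derivative f (at (p + t *\<^sub>R v)) v) (at t)" if "p + t *\<^sub>R v \<in> S" for t
  proof -
    note fd = C_k_on_2D(1)[OF f that]
    show ?thesis
      using has_derivative_compose[OF line fd]
        linear_scale[OF has_derivative_linear[OF fd]]
      by (simp add: has_field_derivative_def mult.commute[of _ "frechet_derivative f (at (p + t *\<^sub>R v)) v"])
  qed
  have "((\<lambda>t. f (p + t *\<^sub>R v)) \<longlongrightarrow> f (p + 0 *\<^sub>R v)) (at_right 0)"
    using DERIV_isCont[OF D[of 0]] S by (simp add: isCont_def filterlim_at_split)
  then show "((\<lambda>t. f (p + t *\<^sub>R v)) \<longlongrightarrow> 0) (at_right 0)" using f0 by simp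
  show "((\<lambda>t. t\<^sup>2) \<longlongrightarrow> 0) (at_right (0::real))"
    by (rule tendsto_eq_intros refl | simp)+
  show "\<forall>\<^sub>F t in at_right 0. ((\<lambda>t. f (p + t *\<^sub>R v)) has_real_derivative
      frechet_derivative f (at (p + t *\<^sub>R v)) v) (at t)"
    using eventually_line_in_open[OF S] by eventually_elim (rule D)
  have pos: "\<forall>\<^sub>F t in at_right (0::real). 0 < t" by (rule eventually_at_right_less)
  show "\<forall>\<^sub>F t in at_right 0. ((\<lambda>t. t\<^sup>2) has_real_derivative 2 * t) (at t)"
    by (auto intro!: always_eventually derivative_eq_intros)
  show "\<forall>\<^sub>F t in at_right 0. t\<^sup>2 \<noteq> (0::real)" "\<forall>\<^sub>F t in at_right 0. 2 * t \<noteq> (0::real)"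
    using pos by (eventually_elim, simp)+
  have "((\<lambda>t. frechet_derivative f (at (p + t *\<^sub>R v)) v) has_derivative
      (\<lambda>h. second_derivative f p (h *\<^sub>R v) v)) (at 0)"
    using has_derivative_compose[OF line[of 0], of _ _] C_k_on_2D(2)[OF f S(2), of v] by simp
  moreover have "second_derivative f p (h *\<^sub>R v) v = second_derivative f p v v * h" for h
    using linear_scale[OF has_derivative_linear[OF C_k_on_2D(2)[OF f S(2), of v]]] by simp
  ultimately have "((\<lambda>t. frechet_derivative f (at (p + t *\<^sub>R v)) v) has_real_derivative
      second_derivative f p v v) (at 0)"
    by (simp add: has_field_derivative_def)
  then have "((\<lambda>t. frechet_derivative f (at (p + t *\<^sub>R v)) v / t)
      \<longlongrightarrow> second_derivative f p v v) (at_right 0)"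
    using df by (simp add: DERIV_def filterlim_at_split)
  from tendsto_divide[OF this tendsto_const[of 2]]
  show "((\<lambda>t. frechet_derivative f (at (p + t *\<^sub>R v)) v / (2 * t))
      \<longlongrightarrow> second_derivative f p v v / 2) (at_right 0)"
    by (simp add: mult.commute)
qed

lemma add_in_ball_iff: "p + x \<in> ball p r \<longleftrightarrow> norm (x :: 'v::real_normed_vector) < r"
  by (simp add: dist_norm)

lemma mean_value_line:
  fixes f :: "'v::real_normed_vector \<Rightarrow> real"
  assumes f: "\<And>q. q \<in> ball p r \<Longrightarrow> (f has_derivative f' q) (at q)"
    and z: "z \<in> ball p r" "z + s *\<^sub>R n \<in> ball p r"
  obtains \<xi> where "\<xi> \<in> ball p r" "f (z + s *\<^sub>R n) = f z + s * f' \<xi> n"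
proof -
  have in_ball: "z + t *\<^sub>R (s *\<^sub>R n) \<in> ball p r" if "t \<in> {0..1}" for t
    using convexD_alt[OF convex_ball z, of t] that by (simp add: algebra_simps)
  have line: "((\<lambda>t. z + t *\<^sub>R (s *\<^sub>R n)) has_derivative (\<lambda>h. h *\<^sub>R (s *\<^sub>R n))) (at t within {0..1})"
    for t :: real
    by (auto intro!: derivative_eq_intros)
  have "\<exists>t\<in>{0<..<1}. f (z + 1 *\<^sub>R (s *\<^sub>R n)) - f (z + 0 *\<^sub>R (s *\<^sub>R n))
      = f' (z + t *\<^sub>R (s *\<^sub>R n)) ((1 - 0) *\<^sub>R (s *\<^sub>R n))"
    by (rule mvt_simple[of 0 1 "\<lambda>t. f (z + t *\<^sub>R (s *\<^sub>R n))"
        "\<lambda>t h. f' (z + t *\<^sub>R (s *\<^sub>R n)) (h *\<^sub>R (s *\<^sub>R n))"])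
      (simp, rule has_derivative_compose[OF line f], rule in_ball, simp)
  then obtain t where t: "t \<in> {0<..<1}" and
    "f (z + s *\<^sub>R n) - f z = f' (z + t *\<^sub>R (s *\<^sub>R n)) (s *\<^sub>R n)"
    by auto
  moreover have b: "z + t *\<^sub>R (s *\<^sub>R n) \<in> ball p r" using t by (intro in_ball) auto
  ultimately show ?thesis
    using that[OF b] linear_scale[OF has_derivative_linear[OF f[OF b]]] by simp
qed

text \<open>If the zeros of \<open>f\<close> near \<open>p\<close> follow the line through \<open>p\<close> in the direction \<open>v\<close> up to a quadratic
  error along \<open>n\<close>, then \<open>f\<close> is quadratically small on the line, with a constant governed by \<open>df(n)\<close>.\<close>
lemma line_estimate:
  fixes f :: "'v::real_normed_vector \<Rightarrow> real"
  assumes S: "open S" "p \<in> S" and f: "\<And>q. q \<in> S \<Longrightarrow> (f has_derivative f' q) (at q)"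
    and cont: "isCont (\<lambda>q. f' q n) p"
    and zero: "\<forall>\<^sub>F t in at_right 0. \<exists>s. \<bar>s\<bar> \<le> C * t\<^sup>2 \<and> f (p + t *\<^sub>R v + s *\<^sub>R n) = 0"
    and e: "0 < e"
  shows "\<forall>\<^sub>F t in at_right 0. \<bar>f (p + t *\<^sub>R v)\<bar> \<le> C * t\<^sup>2 * (\<bar>f' p n\<bar> + e)"
proof -
  from cont e obtain d where d: "d > 0" "\<And>q. dist q p < d \<Longrightarrow> \<bar>f' q n - f' p n\<bar> < e"
    unfolding continuous_at_eps_delta dist_real_def by metis
  from S obtain r0 where r0: "r0 > 0" "ball p r0 \<subseteq> S" using openE by blast
  define r where "r = min d r0"
  have r: "r > 0" "ball p r \<subseteq> S" and bound: "\<And>q. q \<in> ball p r \<Longrightarrow> \<bar>f' q n\<bar> \<le> \<bar>f' p n\<bar> + e"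
    using d r0 by (force simp: r_def dist_commute)+
  have "((\<lambda>t. \<bar>t\<bar> * norm v + C * t\<^sup>2 * norm n) \<longlongrightarrow> \<bar>0\<bar> * norm v + C * 0\<^sup>2 * norm n) (at_right 0)"
    by (intro tendsto_intros)
  then have "\<forall>\<^sub>F t in at_right 0. \<bar>t\<bar> * norm v + C * t\<^sup>2 * norm n < r"
    using r(1) by (intro order_tendstoD(2)) auto
  with zero show ?thesis
  proof eventually_elim
    case (elim t)
    then obtain s where s: "\<bar>s\<bar> \<le> C * t\<^sup>2" "f (p + t *\<^sub>R v + s *\<^sub>R n) = 0" by blast
    have C: "\<bar>s\<bar> * norm n \<le> C * t\<^sup>2 * norm n" using s(1) by (intro mult_right_mono) auto
    have "norm (t *\<^sub>R v + s *\<^sub>R n) < r"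
      using norm_triangle_ineq[of "t *\<^sub>R v" "s *\<^sub>R n"] C elim(2) by simp
    then have b2: "p + t *\<^sub>R v + s *\<^sub>R n \<in> ball p r"
      unfolding add.assoc add_in_ball_iff .
    have "\<bar>t\<bar> * norm v < r"
      using C elim(2) mult_nonneg_nonneg[OF abs_ge_zero[of s] norm_ge_zero[of n]] by linarith
    then have b1: "p + t *\<^sub>R v \<in> ball p r" by (simp add: dist_norm)
    obtain \<xi> where \<xi>: "\<xi> \<in> ball p r" "f (p + t *\<^sub>R v + s *\<^sub>R n) = f (p + t *\<^sub>R v) + s * f' \<xi> n"
      using mean_value_line[OF f b1 b2] r(2) by blast
    then have "\<bar>f (p + t *\<^sub>R v)\<bar> = \<bar>s\<bar> * \<bar>f' \<xi> n\<bar>" using s(2) by (simp add: abs_mult[symmetric])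
    also have "\<dots> \<le> C * t\<^sup>2 * (\<bar>f' p n\<bar> + e)"
      using s(1) bound[OF \<xi>(1)] by (intro mult_mono) auto
    finally show ?case .
  qed
qed

text \<open>A substitute for the implicit function theorem: for \<open>v\<close> in the kernel of \<open>d\<phi>\<close>, the intermediate
  value theorem along \<open>n\<close> produces zeros of \<open>\<phi>\<close> at distance \<open>O(t\<^sup>2)\<close> from \<open>p + t v\<close>.\<close>
lemma zero_set_tangent_points:
  fixes \<phi> :: "'v::real_normed_vector \<Rightarrow> real"
  assumes \<phi>: "C_k_on 2 \<phi> S" and S: "open S" "p \<in> S"
    and \<phi>0: "\<phi> p = 0" and n: "0 < frechet_derivative \<phi> (at p) n"
    and v: "frechet_derivative \<phi> (at p) v = 0"
  obtains C where "0 \<le> C"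
    "\<forall>\<^sub>F t in at_right 0. \<exists>s. \<bar>s\<bar> \<le> C * t\<^sup>2 \<and> p + t *\<^sub>R v + s *\<^sub>R n \<in> S \<and> \<phi> (p + t *\<^sub>R v + s *\<^sub>R n) = 0"
proof -
  define \<phi>' where "\<phi>' q = frechet_derivative \<phi> (at q)" for q
  define m where "m = \<phi>' p n / 2"
  have m: "0 < m" "m < \<phi>' p n" using n by (simp_all add: m_def \<phi>'_def)
  define K where "K = \<bar>second_derivative \<phi> p v v / 2\<bar> + 1"
  define C where "C = K / m"
  have K: "0 < K" by (simp add: K_def)
  then have C: "0 \<le> C" "m * C = K" using m by (simp_all add: C_def)
  have cont: "isCont (\<lambda>q. \<phi>' q n) p" unfolding \<phi>'_def by (rule C_k_on_2D(3)[OF \<phi> S(2)])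
  then have "\<forall>\<^sub>F q in nhds p. m < \<phi>' q n"
    using order_tendstoD(1)[OF isCont_tendsto_nhds] m(2) by blast
  then obtain T where T: "open T" "p \<in> T" "\<And>q. q \<in> T \<Longrightarrow> m < \<phi>' q n"
    unfolding eventually_nhds by blast
  obtain r where r: "r > 0" "ball p r \<subseteq> S \<inter> T" using openE[OF open_Int[OF S(1) T(1)]] S T by blast
  have \<phi>d: "(\<phi> has_derivative \<phi>' q) (at q)" if "q \<in> ball p r" for q
    unfolding \<phi>'_def using C_k_on_2D(1)[OF \<phi>] r that by blast
  have "\<forall>\<^sub>F t in at_right 0. \<bar>\<phi> (p + t *\<^sub>R v) / t\<^sup>2\<bar> < K"
    by (rule order_tendstoD(2)[OF tendsto_rabs[OF taylor2_line[OF \<phi> S \<phi>0 v]]]) (simp add: K_def)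
  moreover have "((\<lambda>t. \<bar>t\<bar> * norm v + C * t\<^sup>2 * norm n) \<longlongrightarrow> \<bar>0\<bar> * norm v + C * 0\<^sup>2 * norm n) (at_right 0)"
    by (intro tendsto_intros)
  then have "\<forall>\<^sub>F t in at_right 0. \<bar>t\<bar> * norm v + C * t\<^sup>2 * norm n < r"
    using r(1) by (intro order_tendstoD(2)) auto
  moreover have "\<forall>\<^sub>F t in at_right (0::real). 0 < t" by (rule eventually_at_right_less)
  ultimately have "\<forall>\<^sub>F t in at_right 0. \<exists>s. \<bar>s\<bar> \<le> C * t\<^sup>2 \<and> p + t *\<^sub>R v + s *\<^sub>R n \<in> S \<and>
      \<phi> (p + t *\<^sub>R v + s *\<^sub>R n) = 0"
  proof eventually_elim
    case (elim t)
    define z where "z = p + t *\<^sub>R v"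
    have z: "\<bar>\<phi> z\<bar> \<le> K * t\<^sup>2" using elim(1,3) by (simp add: z_def field_simps)
    have b: "z + s *\<^sub>R n \<in> ball p r" if "\<bar>s\<bar> \<le> C * t\<^sup>2" for s
    proof -
      have "\<bar>s\<bar> * norm n \<le> C * t\<^sup>2 * norm n" using that by (intro mult_right_mono) auto
      then have "norm (t *\<^sub>R v + s *\<^sub>R n) < r"
        using norm_triangle_ineq[of "t *\<^sub>R v" "s *\<^sub>R n"] elim(2) by simp
      then show ?thesis unfolding z_def add.assoc add_in_ball_iff .
    qed
    have Ct: "0 \<le> C * t\<^sup>2" using C(1) by simp
    have b0: "z \<in> ball p r" using b[of 0] Ct by simp
    have "0 \<le> \<phi> (z + (C * t\<^sup>2) *\<^sub>R n)"
    proof -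
      obtain \<xi> where \<xi>: "\<xi> \<in> ball p r" "\<phi> (z + (C * t\<^sup>2) *\<^sub>R n) = \<phi> z + C * t\<^sup>2 * \<phi>' \<xi> n"
        by (rule mean_value_line[OF \<phi>d b0 b[of "C * t\<^sup>2"]]) (use Ct in auto)
      have "C * t\<^sup>2 * m \<le> C * t\<^sup>2 * \<phi>' \<xi> n" using T(3) \<xi>(1) r(2) Ct by (intro mult_left_mono) (auto simp: less_imp_le)
      moreover have "C * t\<^sup>2 * m = K * t\<^sup>2" using C(2) by (simp add: algebra_simps)
      ultimately show ?thesis using z \<xi>(2) by linarith
    qed
    moreover have "\<phi> (z + (- (C * t\<^sup>2)) *\<^sub>R n) \<le> 0"
    proof -
      obtain \<xi> where \<xi>: "\<xi> \<in> ball p r" "\<phi> (z + (- (C * t\<^sup>2)) *\<^sub>R n) = \<phi> z + (- (C * t\<^sup>2)) * \<phi>' \<xi> n"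
        by (rule mean_value_line[OF \<phi>d b0 b[of "- (C * t\<^sup>2)"]]) (use Ct in auto)
      have "C * t\<^sup>2 * m \<le> C * t\<^sup>2 * \<phi>' \<xi> n" using T(3) \<xi>(1) r(2) Ct by (intro mult_left_mono) (auto simp: less_imp_le)
      moreover have "C * t\<^sup>2 * m = K * t\<^sup>2" using C(2) by (simp add: algebra_simps)
      ultimately show ?thesis using z \<xi>(2) unfolding mult_minus_left by linarith
    qed
    moreover have "continuous_on {- (C * t\<^sup>2)..C * t\<^sup>2} (\<lambda>s. \<phi> (z + s *\<^sub>R n))"
    proof (rule continuous_on_compose2[of "ball p r" \<phi>])
      show "continuous_on (ball p r) \<phi>"
        using \<phi>d has_derivative_continuous continuous_at_imp_continuous_on by blast
      show "(\<lambda>s. z + s *\<^sub>R n) ` {- (C * t\<^sup>2)..C * t\<^sup>2} \<subseteq> ball p r"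
        using b by auto
    qed (intro continuous_intros)
    ultimately obtain s where "- (C * t\<^sup>2) \<le> s" "s \<le> C * t\<^sup>2" "\<phi> (z + s *\<^sub>R n) = 0"
      using IVT'[of "\<lambda>s. \<phi> (z + s *\<^sub>R n)" "- (C * t\<^sup>2)" 0 "C * t\<^sup>2"] Ct by auto
    then show ?case
      unfolding z_def[symmetric] using b r(2) by (intro exI[of _ s]) auto
  qed
  then show ?thesis using that C(1) by blast
qed

text \<open>Two \<open>C\<^sup>2\<close> functions that define the same hypersurface from the same side agree there up to a
  positive factor: to first order, and to second order on vectors of the common kernel. The
  positivity of the factor uses only that both functions are positive on a set \<open>P\<close> accumulating
  at \<open>p\<close>.\<close>
lemma defining_functions_proportional:
  fixes f \<phi> :: "'v::real_normed_vector \<Rightarrow> real"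
  assumes f: "C_k_on 2 f S" and \<phi>: "C_k_on 2 \<phi> S" and S: "open S" "p \<in> S"
    and \<phi>0: "\<phi> p = 0" and zero: "\<And>q. q \<in> S \<Longrightarrow> \<phi> q = 0 \<Longrightarrow> f q = 0"
    and n: "frechet_derivative \<phi> (at p) n' \<noteq> 0" and m: "frechet_derivative f (at p) m \<noteq> 0"
    and P: "p \<in> closure P" "\<And>q. q \<in> P \<Longrightarrow> 0 < f q \<and> 0 < \<phi> q"
  obtains l where "0 < l"
    "\<And>v. frechet_derivative f (at p) v = l * frechet_derivative \<phi> (at p) v"
    "\<And>v. frechet_derivative \<phi> (at p) v = 0 \<Longrightarrow>
       second_derivative f p v v = l * second_derivative \<phi> p v v"
proof -
  define f' \<phi>' where "f' q = frechet_derivative f (at q)"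
    and "\<phi>' q = frechet_derivative \<phi> (at q)" for q
  have fd: "(f has_derivative f' q) (at q)" and \<phi>d: "(\<phi> has_derivative \<phi>' q) (at q)"
    if "q \<in> S" for q
    unfolding f'_def \<phi>'_def using C_k_on_2D(1) f \<phi> that by blast+
  have lin: "linear (f' p)" "linear (\<phi>' p)"
    using fd[OF S(2)] \<phi>d[OF S(2)] has_derivative_linear by blast+
  define n where "n = (1 / \<phi>' p n') *\<^sub>R n'"
  have "\<phi>' p n' \<noteq> 0" using n by (simp add: \<phi>'_def)
  then have n1: "\<phi>' p n = 1" by (simp add: n_def linear_scale[OF lin(2)])
  then have npos: "0 < frechet_derivative \<phi> (at p) n" by (simp add: \<phi>'_def)
  have f0: "f p = 0" using zero S \<phi>0 by blast
  have fc: "isCont (\<lambda>q. f' q n) p" and \<phi>c: "isCont (\<lambda>q. \<phi>' q n) p"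
    unfolding f'_def \<phi>'_def by (rule C_k_on_2D(3)[OF f S(2)] C_k_on_2D(3)[OF \<phi> S(2)])+
  have ker: "f' p v = 0" if v: "\<phi>' p v = 0" for v
  proof -
    obtain C where C: "0 \<le> C" and ev: "\<forall>\<^sub>F t in at_right 0. \<exists>s. \<bar>s\<bar> \<le> C * t\<^sup>2 \<and>
        p + t *\<^sub>R v + s *\<^sub>R n \<in> S \<and> \<phi> (p + t *\<^sub>R v + s *\<^sub>R n) = 0"
      by (rule zero_set_tangent_points[OF \<phi> S \<phi>0 npos v[unfolded \<phi>'_def]])
    have "\<forall>\<^sub>F t in at_right 0. \<exists>s. \<bar>s\<bar> \<le> C * t\<^sup>2 \<and> f (p + t *\<^sub>R v + s *\<^sub>R n) = 0"
      using ev by eventually_elim (use zero in blast)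
    from line_estimate[OF S fd fc this, of 1]
    have "\<forall>\<^sub>F t in at_right 0. \<bar>f (p + t *\<^sub>R v)\<bar> \<le> C * t\<^sup>2 * (\<bar>f' p n\<bar> + 1)" by simp
    moreover have "\<forall>\<^sub>F t in at_right (0::real). 0 < t" by (rule eventually_at_right_less)
    ultimately have "\<forall>\<^sub>F t in at_right 0. norm (f (p + t *\<^sub>R v) / t) \<le> C * t * (\<bar>f' p n\<bar> + 1)"
      by eventually_elim (simp add: field_simps power2_eq_square)
    moreover have "((\<lambda>t. C * t * (\<bar>f' p n\<bar> + 1)) \<longlongrightarrow> 0) (at_right 0)"
      by (rule tendsto_eq_intros refl | simp)+
    ultimately have lim0: "((\<lambda>t. f (p + t *\<^sub>R v) / t) \<longlongrightarrow> 0) (at_right 0)"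
      by (rule Lim_null_comparison)
    have "((\<lambda>t. p + t *\<^sub>R v) has_derivative (\<lambda>h. h *\<^sub>R v)) (at (0::real))"
      by (auto intro!: derivative_eq_intros)
    then have "((\<lambda>t. f (p + t *\<^sub>R v)) has_derivative (\<lambda>h. f' p (h *\<^sub>R v))) (at 0)"
      by (rule has_derivative_compose) (use fd[OF S(2)] in simp)
    then have "((\<lambda>t. f (p + t *\<^sub>R v)) has_real_derivative f' p v) (at 0)"
      by (simp add: has_field_derivative_def linear_scale[OF lin(1)] mult.commute[of _ "f' p v"])
    then have "((\<lambda>t. f (p + t *\<^sub>R v) / t) \<longlongrightarrow> f' p v) (at_right 0)"
      using f0 by (simp add: DERIV_def filterlim_at_split)
    from tendsto_unique[OF _ this lim0] show ?thesis by simp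
  qed
  define l where "l = f' p n"
  have proportional: "f' p v = l * \<phi>' p v" for v
  proof -
    have "\<phi>' p (v - \<phi>' p v *\<^sub>R n) = 0"
      by (simp add: linear_diff[OF lin(2)] linear_scale[OF lin(2)] n1)
    then have "f' p (v - \<phi>' p v *\<^sub>R n) = 0" by (rule ker)
    then show ?thesis
      by (simp add: linear_diff[OF lin(1)] linear_scale[OF lin(1)] l_def mult.commute)
  qed
  have second: "second_derivative f p v v = l * second_derivative \<phi> p v v"
    if v: "\<phi>' p v = 0" for v
  proof -
    \<comment> \<open>\<open>\<psi>\<close> vanishes where \<open>\<phi>\<close> does and has zero differential at \<open>p\<close>, so it is \<open>o(t\<^sup>2)\<close> along the line.\<close>
    define \<psi> where "\<psi> q = f q - l * \<phi> q" for q
    define \<psi>' where "\<psi>' q u = f' q u - l * \<phi>' q u" for q u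
    have \<psi>d: "(\<psi> has_derivative \<psi>' q) (at q)" if "q \<in> S" for q
      unfolding \<psi>_def[abs_def] \<psi>'_def[abs_def] using that
      by (intro has_derivative_diff has_derivative_mult_right fd \<phi>d)
    have \<psi>c: "isCont (\<lambda>q. \<psi>' q n) p"
      unfolding \<psi>'_def by (intro continuous_intros fc \<phi>c)
    have \<psi>n: "\<psi>' p n = 0" by (simp add: \<psi>'_def proportional)
    obtain C where C: "0 \<le> C" and ev: "\<forall>\<^sub>F t in at_right 0. \<exists>s. \<bar>s\<bar> \<le> C * t\<^sup>2 \<and>
        p + t *\<^sub>R v + s *\<^sub>R n \<in> S \<and> \<phi> (p + t *\<^sub>R v + s *\<^sub>R n) = 0"
      by (rule zero_set_tangent_points[OF \<phi> S \<phi>0 npos v[unfolded \<phi>'_def]])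
    have ev': "\<forall>\<^sub>F t in at_right 0. \<exists>s. \<bar>s\<bar> \<le> C * t\<^sup>2 \<and> \<psi> (p + t *\<^sub>R v + s *\<^sub>R n) = 0"
      using ev by eventually_elim (use zero in \<open>force simp: \<psi>_def\<close>)
    define d where "d = (second_derivative f p v v - l * second_derivative \<phi> p v v) / 2"
    have "((\<lambda>t. f (p + t *\<^sub>R v) / t\<^sup>2 - l * (\<phi> (p + t *\<^sub>R v) / t\<^sup>2)) \<longlongrightarrow>
        second_derivative f p v v / 2 - l * (second_derivative \<phi> p v v / 2)) (at_right 0)"
      using v ker[OF v] unfolding f'_def \<phi>'_def
      by (intro tendsto_intros taylor2_line[OF f S f0] taylor2_line[OF \<phi> S \<phi>0])
    then have lim: "((\<lambda>t. \<bar>\<psi> (p + t *\<^sub>R v) / t\<^sup>2\<bar>) \<longlongrightarrow> \<bar>d\<bar>) (at_right 0)"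
      unfolding \<psi>_def d_def by (intro tendsto_rabs) (simp add: diff_divide_distrib)
    have *: "\<bar>d\<bar> \<le> C * e" if e: "0 < e" for e
    proof (rule tendsto_upperbound[OF lim])
      have pos: "\<forall>\<^sub>F t in at_right (0::real). 0 < t" by (rule eventually_at_right_less)
      have "\<forall>\<^sub>F t in at_right 0. \<bar>\<psi> (p + t *\<^sub>R v)\<bar> \<le> C * t\<^sup>2 * (\<bar>\<psi>' p n\<bar> + e)"
        by (rule line_estimate[OF S \<psi>d \<psi>c ev' e])
      then show "\<forall>\<^sub>F t in at_right 0. \<bar>\<psi> (p + t *\<^sub>R v) / t\<^sup>2\<bar> \<le> C * e"
        using pos unfolding \<psi>n by eventually_elim (simp add: field_simps)
    qed simp
    then have "\<bar>d\<bar> \<le> e" if "0 < e" for e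
    proof -
      have "\<bar>d\<bar> \<le> C * (e / (C + 1))" using \<open>0 < e\<close> C by (intro *) simp
      also have "\<dots> \<le> e" using \<open>0 < e\<close> C by (simp add: field_simps)
      finally show ?thesis .
    qed
    then have "d = 0" using field_le_epsilon[of "\<bar>d\<bar>" 0] by simp
    then show ?thesis by (simp add: d_def)
  qed
  have "0 < l"
  proof (rule ccontr)
    \<comment> \<open>Otherwise, going from a point of \<open>P\<close> close to \<open>p\<close> in the direction of \<open>- n\<close>, the function \<open>\<phi>\<close>
      decreases to \<open>0\<close> while \<open>f\<close> stays positive.\<close>
    assume "\<not> 0 < l"
    moreover have "l \<noteq> 0" using m proportional[of m] by (auto simp: f'_def)
    ultimately have l: "f' p n < 0" by (simp add: l_def)
    have "\<forall>\<^sub>F q in nhds p. f' q n < 0" "\<forall>\<^sub>F q in nhds p. 1/2 < \<phi>' q n"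
      using order_tendstoD(2)[OF isCont_tendsto_nhds[OF fc]] l
        order_tendstoD(1)[OF isCont_tendsto_nhds[OF \<phi>c], of "1/2"] n1 by simp_all
    moreover have "\<forall>\<^sub>F q in nhds p. q \<in> S" using S by (auto simp: eventually_nhds)
    ultimately have "\<forall>\<^sub>F q in nhds p. f' q n < 0 \<and> 1/2 < \<phi>' q n \<and> q \<in> S"
      by eventually_elim auto
    then obtain r where r: "r > 0"
      and ball: "\<And>q. q \<in> ball p r \<Longrightarrow> f' q n < 0 \<and> 1/2 < \<phi>' q n \<and> q \<in> S"
      unfolding eventually_nhds_metric by (auto simp: dist_commute)
    have "((\<lambda>q. norm (q - p) + 2 * \<bar>\<phi> q\<bar> * norm n) \<longlongrightarrow> norm (p - p) + 2 * \<bar>\<phi> p\<bar> * norm n) (nhds p)"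
      by (intro tendsto_intros isCont_tendsto_nhds has_derivative_continuous[OF \<phi>d[OF S(2)]]
          filterlim_ident)
    then have "\<forall>\<^sub>F q in nhds p. norm (q - p) + 2 * \<bar>\<phi> q\<bar> * norm n < r"
      using r \<phi>0 by (intro order_tendstoD(2)) auto
    then obtain d where "d > 0" and d: "\<And>q. dist q p < d \<Longrightarrow> norm (q - p) + 2 * \<bar>\<phi> q\<bar> * norm n < r"
      unfolding eventually_nhds_metric by blast
    then obtain z where z: "z \<in> P" "dist z p < d" using P(1) unfolding closure_approachable by blast
    have zpos: "0 < f z" "0 < \<phi> z" using P(2) z by auto
    have b: "z + s *\<^sub>R n \<in> ball p r" if "\<bar>s\<bar> \<le> 2 * \<phi> z" for s
    proof -
      have "\<bar>s\<bar> * norm n \<le> 2 * \<phi> z * norm n" using that by (intro mult_right_mono) auto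
      then have "norm ((z - p) + s *\<^sub>R n) < r"
        using norm_triangle_ineq[of "z - p" "s *\<^sub>R n"] d[OF z(2)] zpos by simp
      then show ?thesis using add_in_ball_iff[of p "(z - p) + s *\<^sub>R n" r] by (simp add: algebra_simps)
    qed
    have b0: "z \<in> ball p r" using b[of 0] zpos by simp
    have \<phi>b: "(\<phi> has_derivative \<phi>' q) (at q)" and fb: "(f has_derivative f' q) (at q)"
      if "q \<in> ball p r" for q using ball that fd \<phi>d by blast+
    obtain \<xi> where \<xi>: "\<xi> \<in> ball p r" "\<phi> (z + (- (2 * \<phi> z)) *\<^sub>R n) = \<phi> z + (- (2 * \<phi> z)) * \<phi>' \<xi> n"
      by (rule mean_value_line[OF \<phi>b b0 b[of "- (2 * \<phi> z)"]]) (use zpos in auto)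
    have "2 * \<phi> z * (1/2) \<le> 2 * \<phi> z * \<phi>' \<xi> n"
      using ball[OF \<xi>(1)] zpos by (intro mult_left_mono) auto
    then have "\<phi> (z + (- (2 * \<phi> z)) *\<^sub>R n) \<le> 0" using \<xi>(2) by simp
    moreover have "continuous_on {- (2 * \<phi> z)..0} (\<lambda>s. \<phi> (z + s *\<^sub>R n))"
    proof (rule continuous_on_compose2[of "ball p r" \<phi>])
      show "continuous_on (ball p r) \<phi>"
        using \<phi>b has_derivative_continuous continuous_at_imp_continuous_on by blast
      show "(\<lambda>s. z + s *\<^sub>R n) ` {- (2 * \<phi> z)..0} \<subseteq> ball p r"
        using b by auto
    qed (intro continuous_intros)
    ultimately obtain s where s: "- (2 * \<phi> z) \<le> s" "s \<le> 0" "\<phi> (z + s *\<^sub>R n) = 0"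
      using IVT'[of "\<lambda>s. \<phi> (z + s *\<^sub>R n)" "- (2 * \<phi> z)" 0 0] zpos by auto
    have bs: "z + s *\<^sub>R n \<in> ball p r" using s b[of s] by simp
    then have "f (z + s *\<^sub>R n) = 0" using zero s(3) ball by blast
    moreover obtain \<eta> where \<eta>: "\<eta> \<in> ball p r" "f (z + s *\<^sub>R n) = f z + s * f' \<eta> n"
      using mean_value_line[OF fb b0 bs] by blast
    moreover have "0 \<le> s * f' \<eta> n" using s(2) ball[OF \<eta>(1)] by (intro mult_nonpos_nonpos) auto
    ultimately show False using zpos by linarith
  qed
  then show ?thesis using that proportional second unfolding f'_def \<phi>'_def by blast
qed

section \<open>Tangent vectors and tensor fields in charts\<close>

lemma smooth_atlasD:
  assumes "smooth_atlas A" "c \<in> A"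
  shows "open (cdom c)" "open (cmap c ` cdom c)" "continuous_on (cdom c) (cmap c)"
    "\<And>z. z \<in> cdom c \<Longrightarrow> cinv c (cmap c z) = z"
    "\<And>q. q \<in> cmap c ` cdom c \<Longrightarrow> cinv c q \<in> cdom c \<and> cmap c (cinv c q) = q"
    "\<And>W. open W \<Longrightarrow> open (cmap c ` (cdom c \<inter> W))"
proof -
  from assms have o: "open (cdom c)" "open (cmap c ` cdom c)"
    and h: "homeomorphism (cdom c) (cmap c ` cdom c) (cmap c) (cinv c)"
    by (auto simp: smooth_atlas_def is_chart_def)
  from h show "continuous_on (cdom c) (cmap c)"
    "\<And>z. z \<in> cdom c \<Longrightarrow> cinv c (cmap c z) = z"
    "\<And>q. q \<in> cmap c ` cdom c \<Longrightarrow> cinv c q \<in> cdom c \<and> cmap c (cinv c q) = q"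
    by (auto simp: homeomorphism_def)
  fix W :: "'a set" assume "open W"
  then have "openin (top_of_set (cdom c)) (cdom c \<inter> W)" by (rule openin_open_Int)
  from homeomorphism_imp_open_map[OF h this] show "open (cmap c ` (cdom c \<inter> W))"
    using o(2) openin_open_trans by blast
qed (use assms in \<open>auto simp: smooth_atlas_def is_chart_def\<close>)

lemma chart_atD:
  assumes "smooth_atlas A"
  shows "chart_at A x \<in> A" "x \<in> cdom (chart_at A x)"
proof -
  have "x \<in> (\<Union>c\<in>A. cdom c)" using assms by (simp add: smooth_atlas_def)
  then have "\<exists>c. c \<in> A \<and> x \<in> cdom c" by blast
  from someI_ex[OF this] show "chart_at A x \<in> A" "x \<in> cdom (chart_at A x)"
    by (auto simp: chart_at_def)
qed

lemma transition_has_derivative: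
  assumes A: "smooth_atlas A" and "c \<in> A" "d \<in> A" "x \<in> cdom c" "x \<in> cdom d"
  shows "((cmap d \<circ> cinv c) has_derivative
    frechet_derivative (cmap d \<circ> cinv c) (at (cmap c x))) (at (cmap c x))"
proof -
  have "C_k_on (Suc 0) (cmap d \<circ> cinv c) (cmap c ` (cdom c \<inter> cdom d))"
    using assms unfolding smooth_atlas_def smooth_on_def by blast
  then show ?thesis
    using assms(4,5) by (simp add: frechet_derivative_works[symmetric])
qed

lemma transition_chain:
  fixes A :: "('a::topological_space, 'e::euclidean_space) chart set"
  assumes A: "smooth_atlas A" and c: "c \<in> A" "x \<in> cdom c" and d: "d \<in> A" "x \<in> cdom d"
    and e: "e \<in> A" "x \<in> cdom e"
  shows "frechet_derivative (cmap e \<circ> cinv c) (at (cmap c x)) a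
    = frechet_derivative (cmap e \<circ> cinv d) (at (cmap d x))
        (frechet_derivative (cmap d \<circ> cinv c) (at (cmap c x)) a)"
proof -
  note cD = smooth_atlasD[OF A c(1)] and dD = smooth_atlasD[OF A d(1)]
  have cx: "(cmap d \<circ> cinv c) (cmap c x) = cmap d x" using cD(4) c by simp
  have "((cmap e \<circ> cinv d) \<circ> (cmap d \<circ> cinv c) has_derivative
      frechet_derivative (cmap e \<circ> cinv d) (at (cmap d x)) \<circ>
      frechet_derivative (cmap d \<circ> cinv c) (at (cmap c x))) (at (cmap c x))"
    using transition_has_derivative[OF A d(1) e(1) d(2) e(2)]
    by (intro diff_chain_at transition_has_derivative[OF A c(1) d(1) c(2) d(2)]) (simp only: cx)
  then have "((cmap e \<circ> cinv c) has_derivative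
      frechet_derivative (cmap e \<circ> cinv d) (at (cmap d x)) \<circ>
      frechet_derivative (cmap d \<circ> cinv c) (at (cmap c x))) (at (cmap c x))"
    by (rule has_derivative_transform_within_open[of _ _ _ _ "cmap c ` (cdom c \<inter> cdom d)"])
      (use cD(4,6) dD(1,4) c d in auto)
  from frechet_derivative_at[OF this, symmetric] show ?thesis by simp
qed

lemma tvec_self:
  fixes A :: "('a::topological_space, 'e::euclidean_space) chart set"
  assumes A: "smooth_atlas A" and c: "c \<in> A" "x \<in> cdom c"
  shows "tvec A x c a c = a"
proof -
  note cD = smooth_atlasD[OF A c(1)]
  have "((\<lambda>q. q) has_derivative (\<lambda>u. u)) (at (cmap c x))" by (rule has_derivative_ident)
  then have "((cmap c \<circ> cinv c) has_derivative (\<lambda>u. u)) (at (cmap c x))"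
    by (rule has_derivative_transform_within_open[of _ _ _ _ "cmap c ` cdom c"])
      (use cD(2,5) c in auto)
  from frechet_derivative_at[OF this, symmetric] c show ?thesis by (simp add: tvec_def)
qed

lemma tvec_in_tangent_space:
  fixes A :: "('a::topological_space, 'e::euclidean_space) chart set"
  assumes A: "smooth_atlas A" and c: "c \<in> A" "x \<in> cdom c"
  shows "tvec A x c a \<in> tangent_space A x"
  unfolding tangent_space_def
proof (intro CollectI conjI allI ballI impI)
  fix d e assume "d \<in> A" "e \<in> A" "x \<in> cdom d \<inter> cdom e"
  then show "tvec A x c a e
      = frechet_derivative (cmap e \<circ> cinv d) (at (cmap d x)) (tvec A x c a d)"
    using transition_chain[OF A c, of d e a] by (simp add: tvec_def)
qed (simp only: tvec_def if_False)

lemma tvec_component: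
  fixes A :: "('a::topological_space, 'e::euclidean_space) chart set"
  assumes "c \<in> A" "x \<in> cdom c" "v \<in> tangent_space A x"
  shows "tvec A x c (v c) = v"
proof (rule ext)
  fix d
  show "tvec A x c (v c) d = v d"
  proof (cases "d \<in> A \<and> x \<in> cdom d")
    case True
    with assms have "v d = frechet_derivative (cmap d \<circ> cinv c) (at (cmap c x)) (v c)"
      unfolding tangent_space_def by blast
    then show ?thesis using True by (simp add: tvec_def)
  next
    case False
    with assms have "v d = 0" unfolding tangent_space_def by blast
    then show ?thesis using False by (auto simp: tvec_def)
  qed
qed

lemma tvec_zero:
  fixes A :: "('a::topological_space, 'e::euclidean_space) chart set"
  assumes A: "smooth_atlas A" and c: "c \<in> A" "x \<in> cdom c"
  shows "tvec A x c 0 = zero_tangent"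
  using linear_0[OF has_derivative_linear[OF transition_has_derivative[OF A c(1) _ c(2)]]]
  by (auto simp: tvec_def fun_eq_iff)

lemma tangent_component_eq_0_iff:
  fixes A :: "('a::topological_space, 'e::euclidean_space) chart set"
  assumes A: "smooth_atlas A" and c: "c \<in> A" "x \<in> cdom c" and v: "v \<in> tangent_space A x"
  shows "v c = 0 \<longleftrightarrow> v = zero_tangent"
  using tvec_component[OF c v] tvec_zero[OF A c] by auto

lemma tangent_space_uminus:
  fixes A :: "('a::topological_space, 'e::euclidean_space) chart set"
  assumes A: "smooth_atlas A" and v: "v \<in> tangent_space A x"
  shows "(\<lambda>c. - v c) \<in> tangent_space A x"
proof -
  have "- v d = frechet_derivative (cmap d \<circ> cinv c) (at (cmap c x)) (- v c)"
    if c: "c \<in> A" "x \<in> cdom c" and d: "d \<in> A" "x \<in> cdom d" for c d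
  proof -
    have "v d = frechet_derivative (cmap d \<circ> cinv c) (at (cmap c x)) (v c)"
      using v c d unfolding tangent_space_def by blast
    then show ?thesis
      using linear_neg[OF has_derivative_linear[OF transition_has_derivative[OF A c(1) d(1) c(2) d(2)]]]
      by simp
  qed
  moreover have "- v c = 0" if "\<not> (c \<in> A \<and> x \<in> cdom c)" for c
  proof -
    have "v c = 0" using v that unfolding tangent_space_def by blast
    then show ?thesis by simp
  qed
  ultimately show ?thesis unfolding tangent_space_def by blast
qed

lemma loc_eq:
  fixes A :: "('a::topological_space, 'e::euclidean_space) chart set"
  assumes A: "smooth_atlas A" and c: "c \<in> A" "x \<in> cdom c"
    and u: "u \<in> tangent_space A x" and v: "v \<in> tangent_space A x"
  shows "loc2 A h c (cmap c x) (u c) (v c) = h x u v" "loc1 A \<omega> c (cmap c x) (u c) = \<omega> x u"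
  using smooth_atlasD(4)[OF A c(1) c(2)] tvec_component[OF c u] tvec_component[OF c v]
  by (simp_all add: loc2_def loc1_def)

lemma inner_product_fieldD:
  fixes A :: "('a::topological_space, 'e::euclidean_space) chart set"
  assumes A: "smooth_atlas A" and h: "inner_product_field A h" and c: "c \<in> A"
    and q: "q \<in> cmap c ` cdom c"
  shows "bilinear (loc2 A h c q)" "loc2 A h c q u v = loc2 A h c q v u"
    "u \<noteq> 0 \<Longrightarrow> 0 < loc2 A h c q u u"
proof -
  show "bilinear (loc2 A h c q)" using h c q by (auto simp: inner_product_field_def)
  have z: "cinv c q \<in> cdom c" using smooth_atlasD(5)[OF A c q] by blast
  note T = tvec_in_tangent_space[OF A c z]
  show "loc2 A h c q u v = loc2 A h c q v u"
    using h T unfolding inner_product_field_def loc2_def by blast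
  assume "u \<noteq> 0"
  then have "tvec A (cinv c q) c u \<noteq> zero_tangent" using tvec_self[OF A c z, of u] by auto
  then show "0 < loc2 A h c q u u"
    using h T unfolding inner_product_field_def loc2_def by blast
qed

lemma loc1_randers_metric:
  "loc1 A (randers_metric h \<omega>) c q u = sqrt (loc2 A h c q u u) + loc1 A \<omega> c q u"
  by (simp add: loc1_def loc2_def randers_metric_def)

lemma fundamental_tensor_randers_metric:
  fixes A :: "('a::topological_space, 'e::euclidean_space) chart set"
  assumes A: "smooth_atlas A" and h: "inner_product_field A h" and w: "covector_field A \<omega>"
    and c: "c \<in> A" and q: "q \<in> cmap c ` cdom c" and y: "y \<noteq> 0"
  shows "fundamental_tensor A (randers_metric h \<omega>) c q y u v
    = randers_tensor (loc2 A h c q) (loc1 A \<omega> c q) y u v"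
proof -
  have "linear (loc1 A \<omega> c q)" using w c q by (auto simp: covector_field_def)
  then show ?thesis
    unfolding fundamental_tensor_def loc1_randers_metric
    by (intro fundamental_tensor_eq_randers_tensor inner_product_fieldD[OF A h c q] y)
qed

lemma covector_bounded:
  fixes H :: "'e::euclidean_space \<Rightarrow> 'e \<Rightarrow> real"
  assumes H: "bilinear H" and sym: "\<And>u v. H u v = H v u" and pos: "\<And>u. u \<noteq> 0 \<Longrightarrow> 0 < H u u"
    and w: "linear w"
  obtains B where "\<And>u. \<bar>w u\<bar> \<le> B * sqrt (H u u)"
proof -
  obtain a where a: "\<And>u. H a u = w u" using bilinear_riesz[OF H pos w] by blast
  have "\<bar>w u\<bar> \<le> sqrt (H a a) * sqrt (H u u)" for u
  proof -
    have "(w u)\<^sup>2 \<le> H a a * H u u" using bilinear_cauchy_schwarz(1)[OF H sym pos, of a u] a by simp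
    then have "sqrt ((w u)\<^sup>2) \<le> sqrt (H a a * H u u)" by (rule real_sqrt_le_mono)
    then show ?thesis by (simp add: real_sqrt_mult)
  qed
  then show ?thesis using that by blast
qed

text \<open>The supremum in the definition of a Randers manifold bounds each quotient because it is taken
  over a bounded set.\<close>
lemma randers_manifold_norm_less:
  fixes A :: "('a::topological_space, 'e::euclidean_space) chart set"
  assumes R: "randers_manifold A h \<omega>" and c: "c \<in> A" and q: "q \<in> cmap c ` cdom c" and u: "u \<noteq> 0"
  shows "\<bar>loc1 A \<omega> c q u\<bar> < sqrt (loc2 A h c q u u)"
proof -
  from R have A: "smooth_atlas A" and h: "inner_product_field A h" and w: "covector_field A \<omega>"
    by (auto simp: randers_manifold_def)
  define z where "z = cinv c q"
  have z: "z \<in> cdom c" "cmap c z = q" using smooth_atlasD(5)[OF A c q] by (auto simp: z_def)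
  let ?f = "\<lambda>y. \<bar>\<omega> z y\<bar> / sqrt (h z y y)"
  let ?T = "tangent_space A z - {zero_tangent}"
  note ip = inner_product_fieldD[OF A h c q]
  have lin: "linear (loc1 A \<omega> c q)" using w c q by (auto simp: covector_field_def)
  obtain B where B: "\<And>u. \<bar>loc1 A \<omega> c q u\<bar> \<le> B * sqrt (loc2 A h c q u u)"
    using covector_bounded[OF ip lin] by blast
  have "?f y \<le> B" if y: "y \<in> ?T" for y
  proof -
    have e: "loc2 A h c q (y c) (y c) = h z y y" "loc1 A \<omega> c q (y c) = \<omega> z y"
      using loc_eq[OF A c z(1), of y y] y z(2) by auto
    have "y c \<noteq> 0" using tangent_component_eq_0_iff[OF A c z(1), of y] y by auto
    from ip(3)[OF this] show ?thesis using B[of "y c"] unfolding e by (simp add: divide_le_eq)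
  qed
  then have bdd: "bdd_above (?f ` ?T)" by (auto intro!: bdd_aboveI[of _ B])
  have t: "tvec A z c u \<in> ?T"
    using tvec_in_tangent_space[OF A c z(1)] tvec_self[OF A c z(1), of u] u by auto
  have "?f (tvec A z c u) \<le> (SUP y\<in>?T. ?f y)" by (rule cSUP_upper[OF t bdd])
  also have "\<dots> < 1" using R unfolding randers_manifold_def by blast
  finally have "\<bar>loc1 A \<omega> c q u\<bar> / sqrt (loc2 A h c q u u) < 1"
    by (simp add: loc1_def loc2_def z_def)
  then show ?thesis using ip(3)[OF u] by (simp add: divide_less_eq)
qed

text \<open>The data \<open>h\<close> and \<open>\<omega>\<close> inherit differentiability from the fundamental tensor \<open>g\<close> of \<open>R\<close>: \<open>R\<close> is the
  square root of \<open>g\<^sub>y(y,y)\<close>, while \<open>(R(y) + R(-y))/2\<close> and \<open>(R(y) - R(-y))/2\<close> are the norm of \<open>h\<close> and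
  \<open>\<omega>(y)\<close>. Polarization then recovers \<open>h\<close>.\<close>
lemma randers_manifold_differentiable:
  fixes A :: "('a::topological_space, 'e::euclidean_space) chart set"
  assumes R: "randers_manifold A h \<omega>" and c: "c \<in> A" and p: "p \<in> cmap c ` cdom c"
  shows "(\<lambda>q. loc2 A h c q u v) differentiable (at p)" "(\<lambda>q. loc1 A \<omega> c q u) differentiable (at p)"
proof -
  from R have A: "smooth_atlas A" and h: "inner_product_field A h" and w: "covector_field A \<omega>"
    and C: "C11_fundamental_tensor A (randers_metric h \<omega>)"
    by (auto simp: randers_manifold_def)
  define S where "S = cmap c ` cdom c"
  have S: "open S" "p \<in> S" using smooth_atlasD(2)[OF A c] p by (auto simp: S_def)
  have ip: "bilinear (loc2 A h c q)" "\<And>u v. loc2 A h c q u v = loc2 A h c q v u"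
    "\<And>u. u \<noteq> 0 \<Longrightarrow> 0 < loc2 A h c q u u" "linear (loc1 A \<omega> c q)"
    "\<And>u. u \<noteq> 0 \<Longrightarrow> \<bar>loc1 A \<omega> c q u\<bar> < sqrt (loc2 A h c q u u)" if "q \<in> S" for q
    using inner_product_fieldD[OF A h c that[unfolded S_def]] w c that[unfolded S_def]
      randers_manifold_norm_less[OF R c that[unfolded S_def]]
    by (auto simp: covector_field_def)
  define F where "F y q = sqrt (loc2 A h c q y y) + loc1 A \<omega> c q y" for y q
  have F: "F y differentiable (at p)" if y: "y \<noteq> 0" for y
  proof -
    have 1: "(\<lambda>(p, y'). fundamental_tensor A (randers_metric h \<omega>) c p y' y y) differentiable (at (p, y))"
      using C c p y unfolding C11_fundamental_tensor_def C11_loc_on_def by blast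
    have 2: "(\<lambda>q. (q, y)) differentiable (at p)"
      by (intro differentiable_Pair differentiable_ident differentiable_const)
    have "(\<lambda>q. fundamental_tensor A (randers_metric h \<omega>) c q y y y) differentiable (at p)"
      using differentiable_chain_at[OF 2 1] by (simp add: o_def)
    moreover have "fundamental_tensor A (randers_metric h \<omega>) c q y y y = (F y q)\<^sup>2" if "q \<in> S" for q
      using fundamental_tensor_randers_metric[OF A h w c that[unfolded S_def] y]
        randers_tensor_diag[OF ip(1,2,3)[OF that] y] by (simp add: F_def)
    ultimately have "(\<lambda>q. (F y q)\<^sup>2) differentiable (at p)"
      by (rule differentiable_cong_open[OF _ S])
    then obtain D where D: "((\<lambda>q. (F y q)\<^sup>2) has_derivative D) (at p)"
      unfolding differentiable_def by blast
    have pos: "0 < F y q" if "q \<in> S" for q using ip(5)[OF that y] by (simp add: F_def)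
    have "(\<lambda>q. sqrt ((F y q)\<^sup>2)) differentiable (at p)"
      unfolding differentiable_def
      by (rule exI, rule has_derivative_real_sqrt[OF _ D]) (use pos[OF S(2)] in simp)
    then show ?thesis
      by (rule differentiable_cong_open[OF _ S]) (use pos in \<open>simp add: less_imp_le\<close>)
  qed
  have neg: "loc1 A \<omega> c q (- y) = - loc1 A \<omega> c q y"
    "loc2 A h c q (- y) (- y) = loc2 A h c q y y" if "q \<in> S" for q y
    using linear_neg[OF ip(4)[OF that]] bilinear_lneg[OF ip(1)[OF that]]
      bilinear_rneg[OF ip(1)[OF that]] by simp_all
  have const: "(\<lambda>q. f q) differentiable (at p)" if "\<And>q. q \<in> S \<Longrightarrow> f q = 0" for f :: "'e \<Rightarrow> real"
    by (rule differentiable_cong_open[OF differentiable_const[of 0] S]) (simp add: that)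
  show "(\<lambda>q. loc1 A \<omega> c q u) differentiable (at p)" for u
  proof (cases "u = 0")
    case False
    have "(\<lambda>q. (F u q - F (- u) q) * (1/2)) differentiable (at p)"
      using False by (intro derivative_intros F) auto
    then show ?thesis
      by (rule differentiable_cong_open[OF _ S]) (simp add: F_def neg)
  qed (auto intro: const simp: linear_0[OF ip(4)])
  have diag: "(\<lambda>q. loc2 A h c q u u) differentiable (at p)" for u
  proof (cases "u = 0")
    case False
    have "(\<lambda>q. ((F u q + F (- u) q) * (1/2))\<^sup>2) differentiable (at p)"
      using False by (intro derivative_intros F) auto
    then show ?thesis
      by (rule differentiable_cong_open[OF _ S])
        (use False ip(3) in \<open>simp add: F_def neg less_imp_le\<close>)
  qed (auto intro: const simp: bilinear_lzero[OF ip(1)])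
  have "(\<lambda>q. (loc2 A h c q (u + v) (u + v) - loc2 A h c q u u - loc2 A h c q v v) * (1/2))
      differentiable (at p)"
    by (intro derivative_intros diag)
  then show "(\<lambda>q. loc2 A h c q u v) differentiable (at p)"
  proof (rule differentiable_cong_open[OF _ S])
    fix q assume q: "q \<in> S"
    show "(loc2 A h c q (u + v) (u + v) - loc2 A h c q u u - loc2 A h c q v v) * (1/2)
        = loc2 A h c q u v"
      using ip(2)[OF q, of v u] by (simp add: bilinear_ladd[OF ip(1)[OF q]] bilinear_radd[OF ip(1)[OF q]])
  qed
qed

lemma loc1_uminus: "loc1 A (\<lambda>x y. - \<omega> x y) c q u = - loc1 A \<omega> c q u"
  by (simp add: loc1_def)

lemma ext_deriv_uminus:
  fixes A :: "('a::topological_space, 'e::euclidean_space) chart set"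
  assumes A: "smooth_atlas A"
    and dw: "\<And>c p u. c \<in> A \<Longrightarrow> p \<in> cmap c ` cdom c \<Longrightarrow> (\<lambda>q. loc1 A \<omega> c q u) differentiable (at p)"
  shows "ext_deriv A (\<lambda>x y. - \<omega> x y) x u v = - ext_deriv A \<omega> x u v"
proof -
  define c where "c = chart_at A x"
  have c: "c \<in> A" "x \<in> cdom c" using chart_atD[OF A] by (auto simp: c_def)
  have "frechet_derivative (\<lambda>q. - loc1 A \<omega> c q u) (at (cmap c x)) v
      = - frechet_derivative (\<lambda>q. loc1 A \<omega> c q u) (at (cmap c x)) v" for u v
    using frechet_derivative_at[OF has_derivative_minus[OF dw[OF c(1),
          unfolded frechet_derivative_works, of "cmap c x" u]], symmetric] c(2) by simp
  then show ?thesis by (simp add: ext_deriv_def Let_def loc1_uminus flip: c_def)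
qed

lemma ext_deriv_uminus_left:
  fixes A :: "('a::topological_space, 'e::euclidean_space) chart set"
  assumes A: "smooth_atlas A" and w: "covector_field A \<omega>"
    and dw: "\<And>c p u. c \<in> A \<Longrightarrow> p \<in> cmap c ` cdom c \<Longrightarrow> (\<lambda>q. loc1 A \<omega> c q u) differentiable (at p)"
  shows "ext_deriv A \<omega> x (\<lambda>c. - u c) v = - ext_deriv A \<omega> x u v"
proof -
  define c where "c = chart_at A x"
  have c: "c \<in> A" "x \<in> cdom c" using chart_atD[OF A] by (auto simp: c_def)
  define p where "p = cmap c x"
  have S: "open (cmap c ` cdom c)" "p \<in> cmap c ` cdom c"
    using smooth_atlasD(2)[OF A c(1)] c by (auto simp: p_def)
  have D: "((\<lambda>q. loc1 A \<omega> c q u) has_derivative frechet_derivative (\<lambda>q. loc1 A \<omega> c q u) (at p)) (at p)"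
    for u using dw[OF c(1) S(2), of u] by (simp add: frechet_derivative_works)
  have "((\<lambda>q. loc1 A \<omega> c q (- u c)) has_derivative
      (\<lambda>v. - frechet_derivative (\<lambda>q. loc1 A \<omega> c q (u c)) (at p) v)) (at p)"
  proof (rule has_derivative_transform_within_open[OF has_derivative_minus[OF D] S])
    fix q assume "q \<in> cmap c ` cdom c"
    then have "linear (loc1 A \<omega> c q)" using w c by (auto simp: covector_field_def)
    then show "- loc1 A \<omega> c q (u c) = loc1 A \<omega> c q (- u c)" by (simp add: linear_neg)
  qed
  from frechet_derivative_at[OF this, symmetric] show ?thesis
    by (simp add: ext_deriv_def Let_def linear_neg[OF has_derivative_linear[OF D]] flip: c_def p_def)
qed

section \<open>Hessians\<close>

text \<open>The components of a representing vector are unique, which makes the definite description in the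
  gradient meaningful.\<close>
lemma gradient_props:
  fixes A :: "('a::topological_space, 'e::euclidean_space) chart set"
  assumes A: "smooth_atlas A" and h: "inner_product_field A h"
    and d: "(f \<circ> cinv (chart_at A x)) differentiable (at (cmap (chart_at A x) x))"
  shows "gradient A h f x \<in> tangent_space A x"
    "\<And>v. v \<in> tangent_space A x \<Longrightarrow> h x (gradient A h f x) v = differential A f x v"
proof -
  define c where "c = chart_at A x"
  have c: "c \<in> A" "x \<in> cdom c" using chart_atD[OF A] by (auto simp: c_def)
  have p: "cmap c x \<in> cmap c ` cdom c" using c by auto
  note ip = inner_product_fieldD[OF A h c(1) p]
  have lin: "linear (frechet_derivative (f \<circ> cinv c) (at (cmap c x)))"
    using linear_frechet_derivative[OF d] by (simp add: c_def)
  have diff: "differential A f x v = frechet_derivative (f \<circ> cinv c) (at (cmap c x)) (v c)" for v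
    by (simp add: differential_def Let_def c_def)
  from bilinear_riesz[OF ip(1,3) lin] obtain a
    where a: "\<And>w. loc2 A h c (cmap c x) a w = frechet_derivative (f \<circ> cinv c) (at (cmap c x)) w"
      by blast
  let ?P = "\<lambda>n. n \<in> tangent_space A x \<and> (\<forall>v\<in>tangent_space A x. h x n v = differential A f x v)"
  have tv: "tvec A x c a \<in> tangent_space A x" for a by (rule tvec_in_tangent_space[OF A c])
  have "\<exists>!n. ?P n"
  proof (intro ex1I[of _ "tvec A x c a"] conjI ballI tv)
    fix v assume v: "v \<in> tangent_space A x"
    show "h x (tvec A x c a) v = differential A f x v"
      using loc_eq(1)[OF A c tv v, of h a] unfolding tvec_self[OF A c] a diff by simp
  next
    fix n assume n: "?P n"
    have "loc2 A h c (cmap c x) (n c) w = loc2 A h c (cmap c x) a w" for w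
      using loc_eq(1)[OF A c conjunct1[OF n] tv, of h w] n tv[of w]
      unfolding tvec_self[OF A c] a diff by (simp add: tvec_self[OF A c])
    then have "n c = a" using ip(3) by (intro bilinear_eqI[OF ip(1)])
    then show "n = tvec A x c a" using tvec_component[OF c conjunct1[OF n]] by simp
  qed
  from theI'[OF this, folded gradient_def]
  show "gradient A h f x \<in> tangent_space A x"
    "\<And>v. v \<in> tangent_space A x \<Longrightarrow> h x (gradient A h f x) v = differential A f x v"
    by blast+
qed

text \<open>The key identity \<open>H\<^sup>R\<^sub>f(y,y) = H\<^sup>h\<^sub>f(y,y) - |y| d\<omega>(y, \<nabla>f)\<close> for \<open>y\<close> in the kernel of \<open>df\<close>. Only the
  differentiability of \<open>h\<close> and \<open>\<omega>\<close> and the bound on \<open>\<omega>\<close> are assumed, not the regularity of the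
  fundamental tensor, so that the identity also applies to \<open>-\<omega>\<close>.\<close>
lemma finsler_hessian_randers:
  fixes A :: "('a::topological_space, 'e::euclidean_space) chart set"
  assumes A: "smooth_atlas A" and h: "inner_product_field A h" and w: "covector_field A \<omega>"
    and dh: "\<And>c p u v. c \<in> A \<Longrightarrow> p \<in> cmap c ` cdom c \<Longrightarrow> (\<lambda>q. loc2 A h c q u v) differentiable (at p)"
    and dw: "\<And>c p u. c \<in> A \<Longrightarrow> p \<in> cmap c ` cdom c \<Longrightarrow> (\<lambda>q. loc1 A \<omega> c q u) differentiable (at p)"
    and small: "\<And>c q u. c \<in> A \<Longrightarrow> q \<in> cmap c ` cdom c \<Longrightarrow> u \<noteq> 0 \<Longrightarrow>
      \<bar>loc1 A \<omega> c q u\<bar> < sqrt (loc2 A h c q u u)"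
    and f: "(f \<circ> cinv (chart_at A x)) differentiable (at (cmap (chart_at A x) x))"
    and y: "y \<in> tangent_space A x" "y \<noteq> zero_tangent" and fy: "differential A f x y = 0"
  shows "finsler_hessian A (randers_metric h \<omega>) f x y y y
    = riemannian_hessian A h f x y y - sqrt (h x y y) * ext_deriv A \<omega> x y (gradient A h f x)"
proof -
  define c where "c = chart_at A x"
  have c: "c \<in> A" "x \<in> cdom c" using chart_atD[OF A] by (auto simp: c_def)
  define p where "p = cmap c x"
  have p: "p \<in> cmap c ` cdom c" using c by (auto simp: p_def)
  define n where "n = gradient A h f x"
  have n: "n \<in> tangent_space A x" "\<And>v. v \<in> tangent_space A x \<Longrightarrow> h x n v = differential A f x v"
    unfolding n_def using gradient_props[OF A h f] by auto
  have yc: "y c \<noteq> 0" using tangent_component_eq_0_iff[OF A c y(1)] y(2) by simp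
  have df: "frechet_derivative (f \<circ> cinv c) (at p) u = loc2 A h c p (n c) u" for u
    using n(2)[OF tvec_in_tangent_space[OF A c], of u]
      loc_eq(1)[OF A c n(1) tvec_in_tangent_space[OF A c], of h u]
    by (simp add: tvec_self[OF A c] differential_def Let_def p_def flip: c_def)
  have ny: "loc2 A h c p (n c) (y c) = 0"
    using fy df[of "y c"] by (simp add: differential_def Let_def p_def flip: c_def)
  have lin: "linear (loc1 A \<omega> c q)" if "q \<in> cmap c ` cdom c" for q
    using w c that by (auto simp: covector_field_def)
  have "loc2 A h c p (n c) (chern_connection A (randers_metric h \<omega>) c p (y c) (y c) (y c))
    = loc2 A h c p (n c) (levi_civita A h c p (y c) (y c)) + sqrt (loc2 A h c p (y c) (y c)) *
      (frechet_derivative (\<lambda>q. loc1 A \<omega> c q (n c)) (at p) (y c)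
        - frechet_derivative (\<lambda>q. loc1 A \<omega> c q (y c)) (at p) (n c))"
  proof (rule randers_chern_diagonal[where S = "cmap c ` cdom c"
        and T = "fundamental_tensor A (randers_metric h \<omega>) c"
        and L = "levi_civita A h c p"
        and N = "chern_connection A (randers_metric h \<omega>) c p (y c)"])
    show "open (cmap c ` cdom c)" by (rule smooth_atlasD(2)[OF A c(1)])
  qed (fact p lin dh[OF c(1) p] dw[OF c(1) p] small[OF c(1) p] yc ny
      levi_civita_def chern_connection_def inner_product_fieldD[OF A h c(1)]
      fundamental_tensor_randers_metric[OF A h w c(1)])+
  moreover have "loc2 A h c p (y c) (y c) = h x y y"
    unfolding p_def by (rule loc_eq(1)[OF A c y(1) y(1)])
  ultimately show ?thesis
    unfolding finsler_hessian_def riemannian_hessian_def ext_deriv_def Let_def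
      c_def[symmetric] n_def[symmetric] p_def[symmetric] df
    by simp
qed

lemma second_derivative_scale:
  fixes f :: "'v::real_normed_vector \<Rightarrow> real"
  assumes f: "C_k_on 2 f S" and S: "open S" "p \<in> S"
  shows "second_derivative f p (r *\<^sub>R u) (r *\<^sub>R v) = r\<^sup>2 * second_derivative f p u v"
proof -
  have "((\<lambda>q. r * frechet_derivative f (at q) v) has_derivative (\<lambda>u. r * second_derivative f p u v)) (at p)"
    by (intro has_derivative_mult_right C_k_on_2D(2)[OF f S(2)])
  then have "((\<lambda>q. frechet_derivative f (at q) (r *\<^sub>R v)) has_derivative
      (\<lambda>u. r * second_derivative f p u v)) (at p)"
    by (rule has_derivative_transform_within_open[OF _ S])
      (simp add: linear_scale[OF has_derivative_linear[OF C_k_on_2D(1)[OF f]]])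
  from frechet_derivative_at[OF this, symmetric]
  have "second_derivative f p (r *\<^sub>R u) (r *\<^sub>R v) = r * second_derivative f p (r *\<^sub>R u) v"
    by (simp add: second_derivative_def)
  then show ?thesis
    using linear_scale[OF has_derivative_linear[OF C_k_on_2D(2)[OF f S(2)]]]
    by (simp add: power2_eq_square)
qed

lemma riemannian_hessian_scale:
  fixes A :: "('a::topological_space, 'e::euclidean_space) chart set"
  assumes A: "smooth_atlas A" and h: "inner_product_field A h"
    and dh: "\<And>c p u v. c \<in> A \<Longrightarrow> p \<in> cmap c ` cdom c \<Longrightarrow> (\<lambda>q. loc2 A h c q u v) differentiable (at p)"
    and f: "C2_function_on A U f" and U: "open U" "x \<in> U"
  shows "riemannian_hessian A h f x (\<lambda>c. r *\<^sub>R u c) (\<lambda>c. r *\<^sub>R v c) = r\<^sup>2 * riemannian_hessian A h f x u v"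
proof -
  define c where "c = chart_at A x"
  have c: "c \<in> A" "x \<in> cdom c" using chart_atD[OF A] by (auto simp: c_def)
  define p where "p = cmap c x"
  have p: "p \<in> cmap c ` cdom c" using c by (auto simp: p_def)
  have fc: "C_k_on 2 (f \<circ> cinv c) (cmap c ` (cdom c \<inter> U))"
    and S: "open (cmap c ` (cdom c \<inter> U))" "p \<in> cmap c ` (cdom c \<inter> U)"
    using f c U smooth_atlasD(6)[OF A c(1) U(1)] by (auto simp: C2_function_on_def p_def)
  note ip = inner_product_fieldD[OF A h c(1)]
  have "bilinear (levi_civita A h c p)"
    unfolding levi_civita_def
    by (rule theI'[OF ex1_levi_civita[OF smooth_atlasD(2)[OF A c(1)] p ip(1,2) ip(3)[OF p] dh[OF c(1) p]],
        THEN conjunct1])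
  then have "levi_civita A h c p (r *\<^sub>R u c) (r *\<^sub>R v c) = r\<^sup>2 *\<^sub>R levi_civita A h c p (u c) (v c)"
    by (simp add: bilinear_lmul bilinear_rmul power2_eq_square)
  then show ?thesis
    unfolding riemannian_hessian_def Let_def c_def[symmetric] p_def[symmetric]
      second_derivative_scale[OF fc S]
    by (simp add: linear_scale[OF has_derivative_linear[OF C_k_on_2D(1)[OF fc S(2)]]] right_diff_distrib)
qed

section \<open>Tangent vectors of the boundary and infinitesimal convexity\<close>

text \<open>A curve run backwards has the opposite velocity.\<close>
lemma boundary_tangent_space_uminus:
  fixes A :: "('a::topological_space, 'e::euclidean_space) chart set"
  assumes A: "smooth_atlas A" and v: "v \<in> boundary_tangent_space A D x"
  shows "(\<lambda>c. - v c) \<in> boundary_tangent_space A D x"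
proof -
  from v obtain \<gamma> e where e: "0 < (e::real)" "\<gamma> 0 = x" "continuous_on {-e<..<e} \<gamma>"
      "\<gamma> ` {-e<..<e} \<subseteq> frontier D" and vt: "v \<in> tangent_space A x"
    and C1: "\<And>c. c \<in> A \<Longrightarrow> (cmap c \<circ> \<gamma>) C1_differentiable_on {t \<in> {-e<..<e}. \<gamma> t \<in> cdom c}"
    and d: "\<And>c. c \<in> A \<Longrightarrow> x \<in> cdom c \<Longrightarrow> ((cmap c \<circ> \<gamma>) has_vector_derivative v c) (at 0)"
    unfolding boundary_tangent_space_def by blast
  define \<delta> where "\<delta> = \<gamma> \<circ> (uminus :: real \<Rightarrow> real)"
  have im: "(uminus :: real \<Rightarrow> real) ` {-e<..<e} = {-e<..<e}" by simp
  have "continuous_on {-e<..<e} \<delta>"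
    unfolding \<delta>_def by (intro continuous_on_compose continuous_intros) (simp add: e(3))
  moreover have "\<delta> ` {-e<..<e} \<subseteq> frontier D"
    unfolding \<delta>_def image_comp[symmetric] im by (rule e(4))
  moreover have "(cmap c \<circ> \<delta>) C1_differentiable_on {t \<in> {-e<..<e}. \<delta> t \<in> cdom c}" if c: "c \<in> A" for c
  proof -
    have im': "uminus ` {t \<in> {-e<..<e}. \<delta> t \<in> cdom c} \<subseteq> {t \<in> {-e<..<e}. \<gamma> t \<in> cdom c}"
      by (auto simp: \<delta>_def)
    have "((cmap c \<circ> \<gamma>) \<circ> uminus) C1_differentiable_on {t \<in> {-e<..<e}. \<delta> t \<in> cdom c}"
    proof (rule C1_differentiable_compose)
      show "(cmap c \<circ> \<gamma>) C1_differentiable_on uminus ` {t \<in> {-e<..<e}. \<delta> t \<in> cdom c}"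
        by (rule C1_differentiable_on_subset[OF C1[OF c] im'])
      show "(uminus :: real \<Rightarrow> real) C1_differentiable_on {t \<in> {-e<..<e}. \<delta> t \<in> cdom c}"
        unfolding C1_differentiable_on_def
        by (intro exI[of _ "\<lambda>_. - 1"]) (auto intro!: derivative_eq_intros)
      show "finite ({t \<in> {-e<..<e}. \<delta> t \<in> cdom c} \<inter> uminus -` {t})" for t :: real
        by (rule finite_subset[of _ "{- t}"]) auto
    qed
    then show ?thesis by (simp add: \<delta>_def o_assoc)
  qed
  moreover have "((cmap c \<circ> \<delta>) has_vector_derivative - v c) (at 0)" if c: "c \<in> A" "x \<in> cdom c" for c
  proof -
    have "((uminus :: real \<Rightarrow> real) has_vector_derivative - 1) (at 0)"
      by (auto intro!: derivative_eq_intros)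
    from vector_diff_chain_at[OF this, of "cmap c \<circ> \<gamma>" "v c"] d[OF c]
    show ?thesis by (simp add: \<delta>_def o_assoc)
  qed
  moreover have "\<delta> 0 = x" by (simp add: \<delta>_def e(2))
  ultimately show ?thesis
    unfolding boundary_tangent_space_def using e(1) tangent_space_uminus[OF A vt] by blast
qed

lemma differential_boundary_tangent:
  fixes A :: "('a::topological_space, 'e::euclidean_space) chart set"
  assumes A: "smooth_atlas A" and f: "defining_function A D x U f"
    and v: "v \<in> boundary_tangent_space A D x"
  shows "differential A f x v = 0"
proof -
  define c where "c = chart_at A x"
  have c: "c \<in> A" "x \<in> cdom c" using chart_atD[OF A] by (auto simp: c_def)
  note cD = smooth_atlasD[OF A c(1)]
  from f have U: "open U" "x \<in> U" and f0: "\<And>q. q \<in> U \<Longrightarrow> q \<in> frontier D \<Longrightarrow> f q = 0"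
    and f2: "C_k_on 2 (f \<circ> cinv c) (cmap c ` (cdom c \<inter> U))"
    using c unfolding defining_function_def C2_function_on_def by blast+
  from v obtain \<gamma> e where e: "0 < (e::real)" "\<gamma> 0 = x" "continuous_on {-e<..<e} \<gamma>"
      "\<gamma> ` {-e<..<e} \<subseteq> frontier D"
    and d: "((cmap c \<circ> \<gamma>) has_vector_derivative v c) (at 0)"
    using c unfolding boundary_tangent_space_def by blast
  define I where "I = {-e<..<e} \<inter> \<gamma> -` (cdom c \<inter> U)"
  have I: "open I" "0 \<in> I"
    unfolding I_def using e c U cD(1)
    by (auto intro!: continuous_open_preimage simp del: vimage_Int)
  let ?f' = "frechet_derivative (f \<circ> cinv c) (at (cmap c x))"
  have "((f \<circ> cinv c) has_derivative ?f') (at (cmap c x))"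
    by (rule C_k_on_2D(1)[OF f2]) (use c U in auto)
  then have fd: "((f \<circ> cinv c) has_derivative ?f') (at ((cmap c \<circ> \<gamma>) 0))"
    by (simp add: e(2))
  have "((f \<circ> cinv c) \<circ> (cmap c \<circ> \<gamma>) has_derivative ?f' \<circ> (\<lambda>t. t *\<^sub>R v c)) (at 0)"
    using d fd unfolding has_vector_derivative_def by (rule diff_chain_at)
  then have "((\<lambda>_. 0) has_derivative ?f' \<circ> (\<lambda>t. t *\<^sub>R v c)) (at (0::real))"
  proof (rule has_derivative_transform_within_open[OF _ I])
    fix t assume "t \<in> I"
    then show "((f \<circ> cinv c) \<circ> (cmap c \<circ> \<gamma>)) t = 0"
    proof -
      have "\<gamma> t \<in> frontier D" "\<gamma> t \<in> U" "\<gamma> t \<in> cdom c" using \<open>t \<in> I\<close> e(4) by (auto simp: I_def)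
      then show ?thesis using cD(4) f0 by simp
    qed
  qed
  from has_derivative_unique[OF this has_derivative_const]
  have "?f' (1 *\<^sub>R v c) = 0" by (metis comp_apply)
  then show ?thesis by (simp add: differential_def Let_def flip: c_def)
qed

text \<open>The factor does not depend on \<open>F\<close>, and nothing is required of \<open>F\<close>: the connection enters only
  through the differentials of the two functions, which are proportional.\<close>
lemma finsler_hessian_defining_function:
  fixes A :: "('a::topological_space, 'e::euclidean_space) chart set"
  assumes A: "smooth_atlas A" and x: "x \<in> frontier D"
    and f: "defining_function A D x U f" and g: "defining_function A D x V g"
  obtains l where "0 < l" "\<And>F y. y \<in> boundary_tangent_space A D x \<Longrightarrow>
    finsler_hessian A F f x y y y = l * finsler_hessian A F g x y y y"
proof -
  define c where "c = chart_at A x"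
  have c: "c \<in> A" "x \<in> cdom c" using chart_atD[OF A] by (auto simp: c_def)
  note cD = smooth_atlasD[OF A c(1)]
  define p where "p = cmap c x"
  define S where "S = cmap c ` (cdom c \<inter> (U \<inter> V))"
  define P where "P = cmap c ` (cdom c \<inter> (U \<inter> V) \<inter> D)"
  from f have U: "open U" "x \<in> U" and f2: "C_k_on 2 (f \<circ> cinv c) (cmap c ` (cdom c \<inter> U))"
    and f0: "\<And>q. q \<in> U \<Longrightarrow> q \<in> frontier D \<Longrightarrow> f q = 0" and fpos: "\<And>q. q \<in> U \<Longrightarrow> q \<in> D \<Longrightarrow> 0 < f q"
    and fd: "\<exists>v. differential A f x v \<noteq> 0"
    using c x unfolding defining_function_def C2_function_on_def by blast+
  from g have V: "open V" "x \<in> V" and g2: "C_k_on 2 (g \<circ> cinv c) (cmap c ` (cdom c \<inter> V))"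
    and g0: "\<And>q. q \<in> V \<Longrightarrow> g q = 0 \<longleftrightarrow> q \<in> frontier D" and gpos: "\<And>q. q \<in> V \<Longrightarrow> q \<in> D \<Longrightarrow> 0 < g q"
    and gd: "\<exists>v. differential A g x v \<noteq> 0"
    using c x unfolding defining_function_def C2_function_on_def by blast+
  have mono: "C_k_on 2 k T'" if "C_k_on 2 k T" "T' \<subseteq> T" for k :: "'e \<Rightarrow> real" and T T'
    using that unfolding numeral_2_eq_2 C_k_on.simps by (blast intro: continuous_on_subset)
  have S: "open S" "p \<in> S" unfolding S_def p_def using cD(6)[of "U \<inter> V"] U V c by auto
  have f2': "C_k_on 2 (f \<circ> cinv c) S" and g2': "C_k_on 2 (g \<circ> cinv c) S"
    by (rule mono[OF f2] mono[OF g2]; force simp: S_def)+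
  obtain n m where n: "frechet_derivative (g \<circ> cinv c) (at p) n \<noteq> 0"
    and m: "frechet_derivative (f \<circ> cinv c) (at p) m \<noteq> 0"
    using fd gd unfolding differential_def Let_def c_def[symmetric] p_def[symmetric] by blast
  have gp: "(g \<circ> cinv c) p = 0" using cD(4) c V g0 x by (simp add: p_def)
  have zero: "(f \<circ> cinv c) q = 0" if "q \<in> S" "(g \<circ> cinv c) q = 0" for q
    using that f0 g0 cD(4) by (auto simp: S_def)
  have clos: "p \<in> closure P"
    unfolding closure_iff_nhds_not_empty
  proof (intro allI impI)
    fix B T assume T: "T \<subseteq> B" "open T" "p \<in> T"
    have "open (cdom c \<inter> cmap c -` T)"
      using cD(1,3) T(2) by (intro continuous_open_preimage)
    then have "open ((cdom c \<inter> cmap c -` T) \<inter> (U \<inter> V))" using U V by blast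
    moreover have "x \<in> (cdom c \<inter> cmap c -` T) \<inter> (U \<inter> V)" using c U V T by (simp add: p_def)
    moreover have "x \<in> closure D" using x by (simp add: frontier_def)
    ultimately obtain z where "z \<in> D" "z \<in> (cdom c \<inter> cmap c -` T) \<inter> (U \<inter> V)"
      unfolding closure_iff_nhds_not_empty by blast
    then show "P \<inter> B \<noteq> {}" using T(1) unfolding P_def by blast
  qed
  have Ppos: "0 < (f \<circ> cinv c) q \<and> 0 < (g \<circ> cinv c) q" if "q \<in> P" for q
    using that fpos gpos cD(4) by (auto simp: P_def)
  have "\<exists>l>0.
    (\<forall>v. frechet_derivative (f \<circ> cinv c) (at p) v = l * frechet_derivative (g \<circ> cinv c) (at p) v) \<and>
    (\<forall>v. frechet_derivative (g \<circ> cinv c) (at p) v = 0 \<longrightarrow>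
       second_derivative (f \<circ> cinv c) p v v = l * second_derivative (g \<circ> cinv c) p v v)"
    by (rule defining_functions_proportional[OF f2' g2' S gp zero n m clos Ppos]) blast+
  then obtain l where l: "0 < l"
    "\<And>v. frechet_derivative (f \<circ> cinv c) (at p) v = l * frechet_derivative (g \<circ> cinv c) (at p) v"
    "\<And>v. frechet_derivative (g \<circ> cinv c) (at p) v = 0 \<Longrightarrow>
       second_derivative (f \<circ> cinv c) p v v = l * second_derivative (g \<circ> cinv c) p v v"
    by blast
  show ?thesis
  proof (rule that[OF l(1)])
    fix F y assume "y \<in> boundary_tangent_space A D x"
    from differential_boundary_tangent[OF A g this]
    have "frechet_derivative (g \<circ> cinv c) (at p) (y c) = 0"
      by (simp add: differential_def Let_def p_def flip: c_def)
    then show "finsler_hessian A F f x y y y = l * finsler_hessian A F g x y y y"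
      unfolding finsler_hessian_def Let_def c_def[symmetric] p_def[symmetric]
      by (simp add: l(2,3) right_diff_distrib)
  qed
qed

lemma infinitesimally_convex_iff:
  fixes A :: "('a::topological_space, 'e::euclidean_space) chart set"
  assumes A: "smooth_atlas A" and x: "x \<in> frontier D" and g: "defining_function A D x V g"
  shows "infinitesimally_convex A F D x \<longleftrightarrow>
    (\<forall>y\<in>boundary_tangent_space A D x - {zero_tangent}. finsler_hessian A F g x y y y \<le> 0)"
proof
  assume "infinitesimally_convex A F D x"
  then obtain U f where f: "defining_function A D x U f"
    and le: "\<And>y. y \<in> boundary_tangent_space A D x - {zero_tangent} \<Longrightarrow> finsler_hessian A F f x y y y \<le> 0"
    unfolding infinitesimally_convex_def by blast
  obtain l where "0 < l" "\<And>F y. y \<in> boundary_tangent_space A D x \<Longrightarrow>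
    finsler_hessian A F g x y y y = l * finsler_hessian A F f x y y y"
    using finsler_hessian_defining_function[OF A x g f] by blast
  then show "\<forall>y\<in>boundary_tangent_space A D x - {zero_tangent}. finsler_hessian A F g x y y y \<le> 0"
    using le by (simp add: mult_le_0_iff)
qed (use g in \<open>auto simp: infinitesimally_convex_def\<close>)

section \<open>Equivalence of the convexity conditions\<close>

theorem proposition2p4:
  fixes A :: "('a::{t2_space, second_countable_topology}, 'e::euclidean_space) chart set"
    and h :: "('a, 'e) metric"
    and \<omega> :: "('a, 'e) tangent_function"
    and D U :: "'a set" and x :: 'a and \<phi> :: "'a \<Rightarrow> real"
  assumes "randers_manifold A h \<omega>"
    and "C2_domain A D"
    and "x \<in> frontier D"
    and "defining_function A D x U \<phi>"
  shows
    "(infinitesimally_convex A (randers_metric h \<omega>) D x \<longleftrightarrow>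
      infinitesimally_convex A (reversed_randers_metric h \<omega>) D x) \<and>
     (infinitesimally_convex A (reversed_randers_metric h \<omega>) D x \<longleftrightarrow>
      (\<forall>y\<in>boundary_tangent_space A D x.
         riemannian_hessian A h \<phi> x y y
           + sqrt (h x y y) * ext_deriv A \<omega> x y (gradient A h \<phi> x) \<le> 0)) \<and>
     ((\<forall>y\<in>boundary_tangent_space A D x.
         riemannian_hessian A h \<phi> x y y
           + sqrt (h x y y) * ext_deriv A \<omega> x y (gradient A h \<phi> x) \<le> 0) \<longleftrightarrow>
      (\<forall>y\<in>boundary_tangent_space A D x.
         riemannian_hessian A h \<phi> x y y
           - sqrt (h x y y) * ext_deriv A \<omega> x y (gradient A h \<phi> x) \<le> 0)) \<and>
     ((\<forall>y\<in>boundary_tangent_space A D x.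
         riemannian_hessian A h \<phi> x y y
           - sqrt (h x y y) * ext_deriv A \<omega> x y (gradient A h \<phi> x) \<le> 0) \<longleftrightarrow>
      (\<forall>y\<in>boundary_tangent_space A D x.
         riemannian_hessian A h \<phi> x y y
           + sqrt (h x y y) * \<bar>ext_deriv A \<omega> x y (gradient A h \<phi> x)\<bar> \<le> 0))"
proof -
  note R = assms(1) and x = assms(3) and \<phi> = assms(4)
  from R have A: "smooth_atlas A" and h: "inner_product_field A h" and w: "covector_field A \<omega>"
    by (auto simp: randers_manifold_def)
  note dh = randers_manifold_differentiable(1)[OF R] and dw = randers_manifold_differentiable(2)[OF R]
    and small = randers_manifold_norm_less[OF R]
  define T where "T = boundary_tangent_space A D x"
  define H where "H y = riemannian_hessian A h \<phi> x y y" for y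
  define \<delta> where "\<delta> y = sqrt (h x y y) * ext_deriv A \<omega> x y (gradient A h \<phi> x)" for y
  define \<eta> where "\<eta> = (\<lambda>x y. - \<omega> x y)"
  have U: "open U" "x \<in> U" and \<phi>2: "C2_function_on A U \<phi>"
    using \<phi> by (auto simp: defining_function_def)
  have c: "chart_at A x \<in> A" "x \<in> cdom (chart_at A x)" using chart_atD[OF A] by auto
  have \<phi>d: "(\<phi> \<circ> cinv (chart_at A x)) differentiable (at (cmap (chart_at A x) x))"
    using \<phi>2 c U C_k_on_2D(1) unfolding C2_function_on_def differentiable_def by blast
  have Tt: "y \<in> tangent_space A x" if "y \<in> T" for y
    using that by (auto simp: T_def boundary_tangent_space_def)
  have T0: "differential A \<phi> x y = 0" if "y \<in> T" for y
    using differential_boundary_tangent[OF A \<phi>] that by (simp add: T_def)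
  have Tneg: "(\<lambda>c. - y c) \<in> T" if "y \<in> T" for y
    using boundary_tangent_space_uminus[OF A] that by (simp add: T_def)

  have zero: "H zero_tangent = 0" "\<delta> zero_tangent = 0"
  proof -
    show "H zero_tangent = 0"
      using riemannian_hessian_scale[OF A h dh \<phi>2 U, of 0 zero_tangent zero_tangent]
      by (simp add: H_def)
    show "\<delta> zero_tangent = 0"
      using loc_eq(1)[OF A c, of zero_tangent zero_tangent h]
        tvec_in_tangent_space[OF A c, of 0] bilinear_lzero[OF inner_product_fieldD(1)[OF A h c(1)]] c(2)
      by (simp add: \<delta>_def tvec_zero[OF A c])
  qed
  have neg: "H (\<lambda>c. - y c) = H y" "\<delta> (\<lambda>c. - y c) = - \<delta> y" if y: "y \<in> T" for y
  proof -
    show "H (\<lambda>c. - y c) = H y"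
      using riemannian_hessian_scale[OF A h dh \<phi>2 U, of "- 1" y y] by (simp add: H_def)
    have "bilinear (loc2 A h (chart_at A x) (cmap (chart_at A x) x))"
      using inner_product_fieldD(1)[OF A h c(1)] c(2) by blast
    then have "h x (\<lambda>c. - y c) (\<lambda>c. - y c) = h x y y"
      using loc_eq(1)[OF A c Tt[OF y] Tt[OF y], of h]
        loc_eq(1)[OF A c Tt[OF Tneg[OF y]] Tt[OF Tneg[OF y]], of h]
      by (simp add: bilinear_lneg bilinear_rneg)
    then show "\<delta> (\<lambda>c. - y c) = - \<delta> y"
      by (simp add: \<delta>_def ext_deriv_uminus_left[OF A w dw])
  qed

  \<comment> \<open>Convexity only tests \<open>y \<noteq> 0\<close>, the inequalities also \<open>y = 0\<close>, where they hold trivially.\<close>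
  have conv: "infinitesimally_convex A F D x \<longleftrightarrow> (\<forall>y\<in>T. H y + s * \<delta> y \<le> 0)"
    if "\<And>y. y \<in> T \<Longrightarrow> y \<noteq> zero_tangent \<Longrightarrow> finsler_hessian A F \<phi> x y y y = H y + s * \<delta> y" for F s
    unfolding infinitesimally_convex_iff[OF A x \<phi>] T_def[symmetric]
    using that zero by (metis (no_types, lifting) Diff_iff add_0 insert_iff mult_zero_right order_refl empty_iff)
  have i: "infinitesimally_convex A (randers_metric h \<omega>) D x \<longleftrightarrow> (\<forall>y\<in>T. H y - \<delta> y \<le> 0)"
    using conv[of "randers_metric h \<omega>" "- 1"]
      finsler_hessian_randers[OF A h w dh dw small \<phi>d Tt _ T0]
    by (simp add: H_def \<delta>_def)
  have "reversed_randers_metric h \<omega> = randers_metric h \<eta>"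
    by (simp add: reversed_randers_metric_def randers_metric_def \<eta>_def)
  moreover have "finsler_hessian A (randers_metric h \<eta>) \<phi> x y y y = H y + 1 * \<delta> y"
    if "y \<in> T" "y \<noteq> zero_tangent" for y
  proof -
    have "covector_field A \<eta>"
      using w unfolding covector_field_def \<eta>_def loc1_uminus[abs_def]
      by (auto intro: linear_compose_neg)
    moreover have "(\<lambda>q. loc1 A \<eta> c q u) differentiable (at p)" if "c \<in> A" "p \<in> cmap c ` cdom c" for c p u
      unfolding \<eta>_def loc1_uminus by (intro differentiable_minus dw that)
    moreover have "\<bar>loc1 A \<eta> c q u\<bar> < sqrt (loc2 A h c q u u)"
      if "c \<in> A" "q \<in> cmap c ` cdom c" "u \<noteq> 0" for c q u
      unfolding \<eta>_def loc1_uminus using small[OF that] by simp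
    ultimately have "finsler_hessian A (randers_metric h \<eta>) \<phi> x y y y
        = H y - sqrt (h x y y) * ext_deriv A \<eta> x y (gradient A h \<phi> x)"
      unfolding H_def by (intro finsler_hessian_randers[OF A h _ dh _ _ \<phi>d Tt _ T0] that)
    then show ?thesis by (simp add: \<delta>_def \<eta>_def ext_deriv_uminus[OF A dw])
  qed
  ultimately have ii: "infinitesimally_convex A (reversed_randers_metric h \<omega>) D x
      \<longleftrightarrow> (\<forall>y\<in>T. H y + \<delta> y \<le> 0)"
    using conv[of "randers_metric h \<eta>" 1] by simp
  \<comment> \<open>Both inequalities are exchanged by \<open>y \<mapsto> - y\<close>.\<close>
  have iv: "(\<forall>y\<in>T. H y + \<delta> y \<le> 0) \<longleftrightarrow> (\<forall>y\<in>T. H y - \<delta> y \<le> 0)"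
  proof (intro iffI ballI)
    fix y assume y: "y \<in> T"
    { assume "\<forall>y\<in>T. H y + \<delta> y \<le> 0"
      from bspec[OF this Tneg[OF y]] show "H y - \<delta> y \<le> 0" by (simp add: neg[OF y]) }
    { assume "\<forall>y\<in>T. H y - \<delta> y \<le> 0"
      from bspec[OF this Tneg[OF y]] show "H y + \<delta> y \<le> 0" by (simp add: neg[OF y]) }
  qed
  have sq: "0 \<le> sqrt (h x y y)" if y: "y \<in> T" for y
  proof (cases "y = zero_tangent")
    case False
    then have "0 < h x y y" using h Tt[OF y] unfolding inner_product_field_def by blast
    then show ?thesis by simp
  next
    case True
    then show ?thesis
      using loc_eq(1)[OF A c, of zero_tangent zero_tangent h]
        tvec_in_tangent_space[OF A c, of 0] bilinear_lzero[OF inner_product_fieldD(1)[OF A h c(1)]] c(2)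
      by (simp add: tvec_zero[OF A c])
  qed
  have "sqrt (h x y y) * \<bar>ext_deriv A \<omega> x y (gradient A h \<phi> x)\<bar> = \<bar>\<delta> y\<bar>" if "y \<in> T" for y
    using sq[OF that] by (simp add: \<delta>_def abs_mult)
  moreover have "(\<forall>y\<in>T. H y - \<delta> y \<le> 0) \<longleftrightarrow> (\<forall>y\<in>T. H y + \<bar>\<delta> y\<bar> \<le> 0)"
  proof
    assume "\<forall>y\<in>T. H y - \<delta> y \<le> 0"
    then have "H y - \<delta> y \<le> 0" "H y + \<delta> y \<le> 0" if "y \<in> T" for y using iv that by auto
    then show "\<forall>y\<in>T. H y + \<bar>\<delta> y\<bar> \<le> 0" by (auto simp: abs_if)
  next
    assume "\<forall>y\<in>T. H y + \<bar>\<delta> y\<bar> \<le> 0"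
    then show "\<forall>y\<in>T. H y - \<delta> y \<le> 0" by (auto simp: abs_if split: if_splits)
  qed
  ultimately have v: "(\<forall>y\<in>T. H y - \<delta> y \<le> 0) \<longleftrightarrow> (\<forall>y\<in>T. H y
      + sqrt (h x y y) * \<bar>ext_deriv A \<omega> x y (gradient A h \<phi> x)\<bar> \<le> 0)"
    by simp
  show ?thesis
    unfolding T_def[symmetric] H_def[symmetric] \<delta>_def[symmetric]
    using i ii iv v by blast
qed

end
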